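(* Let $0<\alpha<1$. Let $\{M_0(t)\}_{t\ge0}$ and $\{M(t)\}_{t\ge0}$ be independent generalized counting processes with positive rates $\mu_1,\dots,\mu_{k_0}$ and $\lambda_1,\dots,\lambda_k$, respectively, and let $\hat M^\alpha(t)=M(M_0(Y^\alpha(t)))$, where $\{Y^\alpha(t)\}_{t\ge0}$ is an inverse $\alpha$-stable subordinator independent of $(M,M_0)$. Then the process $\{\hat M^\alpha(t)\}_{t\ge0}$ exhibits the long-range dependence property.
   Context: A generalized counting process (GCP) $\{M(t)\}_{t\ge0}$ with positive rates $\lambda_1,\dots,\lambda_k$ is a right-continuous $\mathbb{N}_0$-valued process with $M(0)=0$ and stationary independent increments, whose probability generating function is $\mathbb{E}(u^{M(t)})=\exp\big(-t\sum_{j=1}^{k}\lambda_j(1-u^j)\big)$, $|u|\le1$. An $\alpha$-stable subordinator $D^\alpha$ is a non-decreasing Lévy process with $\mathbb{E}(e^{-sD^\alpha(t)})=e^{-ts^\alpha}$, $s>0$; the inverse $\alpha$-stable subordinator is $Y^\alpha(t)=\inf\{x>0:D^\alpha(x)>t\}$. The process $\hat M^\alpha$ is called the time-changed IGCP. A non-stationary process $\{X(t)\}_{t\ge0}$ exhibits the long-range dependence (LRD) property if there is $\theta\in(0,1)$ such that for each fixed $s>0$ there is $c(s)>0$ with $\operatorname{Corr}(X(s),X(t))\sim c(s)t^{-\theta}$ as $t\to\infty$; here $f(t)\sim g(t)$ means $f(t)/g(t)\to1$. *)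

theory Defs
  imports "HOL-Probability.Probability" "HOL-Library.Landau_Symbols"
begin

(* A process indexed by [0,\<infinity>) is a function X :: real \<Rightarrow> 'a \<Rightarrow> 'b of which only the values
   X t with t \<ge> 0 matter. *)

context prob_space
begin

definition independent_increments :: "(real \<Rightarrow> 'a \<Rightarrow> real) \<Rightarrow> bool" where
  "independent_increments X \<longleftrightarrow>
     (\<forall>(n::nat) t. 0 \<le> t 0 \<longrightarrow> (\<forall>i<n. t i < t (Suc i)) \<longrightarrow>
        indep_vars (\<lambda>_. borel) (\<lambda>i \<omega>. X (t (Suc i)) \<omega> - X (t i) \<omega>) {..<n})"

definition stationary_increments :: "(real \<Rightarrow> 'a \<Rightarrow> real) \<Rightarrow> bool" where
  "stationary_increments X \<longleftrightarrow>
     (\<forall>t\<ge>0. \<forall>h\<ge>0. distr M borel (\<lambda>\<omega>. X (t + h) \<omega> - X t \<omega>) = distr M borel (\<lambda>\<omega>. X h \<omega> - X 0 \<omega>))"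

(* The increments are formed in the reals because subtraction on nat truncates. *)
definition generalized_counting_process ::
    "nat \<Rightarrow> (nat \<Rightarrow> real) \<Rightarrow> (real \<Rightarrow> 'a \<Rightarrow> nat) \<Rightarrow> bool" where
  "generalized_counting_process k r N \<longleftrightarrow>
     (\<forall>t\<ge>0. random_variable (count_space UNIV) (N t)) \<and>
     (\<forall>\<omega>\<in>space M. N 0 \<omega> = 0) \<and>
     (\<forall>\<omega>\<in>space M. \<forall>t\<ge>0. continuous (at_right t) (\<lambda>s. N s \<omega>)) \<and>
     independent_increments (\<lambda>t \<omega>. real (N t \<omega>)) \<and>
     stationary_increments (\<lambda>t \<omega>. real (N t \<omega>)) \<and>
     (\<forall>t\<ge>0. \<forall>u::real. \<bar>u\<bar> \<le> 1 \<longrightarrow>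
        expectation (\<lambda>\<omega>. u ^ N t \<omega>) = exp (- t * (\<Sum>j=1..k. r j * (1 - u ^ j))))"

definition levy_process :: "(real \<Rightarrow> 'a \<Rightarrow> real) \<Rightarrow> bool" where
  "levy_process X \<longleftrightarrow>
     (\<forall>t\<ge>0. random_variable borel (X t)) \<and>
     (AE \<omega> in M. X 0 \<omega> = 0) \<and>
     independent_increments X \<and>
     stationary_increments X \<and>
     (\<forall>t\<ge>0. \<forall>e>0. ((\<lambda>s. prob {\<omega>\<in>space M. e < \<bar>X s \<omega> - X t \<omega>\<bar>}) \<longlongrightarrow> 0) (at t within {0..})) \<and>
     (\<forall>\<omega>\<in>space M. \<forall>t\<ge>0. continuous (at_right t) (\<lambda>s. X s \<omega>)) \<and>
     (\<forall>\<omega>\<in>space M. \<forall>t>0. \<exists>l. ((\<lambda>s. X s \<omega>) \<longlongrightarrow> l) (at_left t))"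

definition stable_subordinator :: "real \<Rightarrow> (real \<Rightarrow> 'a \<Rightarrow> real) \<Rightarrow> bool" where
  "stable_subordinator \<alpha> D \<longleftrightarrow>
     levy_process D \<and>
     (\<forall>\<omega>\<in>space M. mono_on {0..} (\<lambda>t. D t \<omega>)) \<and>
     (\<forall>t\<ge>0. \<forall>s>0. expectation (\<lambda>\<omega>. exp (- s * D t \<omega>)) = exp (- t * s powr \<alpha>))"

(* The set of passage times is empty only on a null event (a path of D that stays bounded by t).
   The infimum of the empty set of reals is unspecified in HOL; there the value 0 is used. *)
definition inverse_stable_subordinator :: "real \<Rightarrow> (real \<Rightarrow> 'a \<Rightarrow> real) \<Rightarrow> bool" where
  "inverse_stable_subordinator \<alpha> Y \<longleftrightarrow>
     (\<exists>D. stable_subordinator \<alpha> D \<and>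
        (\<forall>t\<ge>0. \<forall>\<omega>\<in>space M.
           Y t \<omega> = (if \<exists>x>0. t < D x \<omega> then Inf {x. 0 < x \<and> t < D x \<omega>} else 0)))"

definition covariance :: "('a \<Rightarrow> real) \<Rightarrow> ('a \<Rightarrow> real) \<Rightarrow> real" where
  "covariance X Y = expectation (\<lambda>\<omega>. (X \<omega> - expectation X) * (Y \<omega> - expectation Y))"

definition correlation :: "('a \<Rightarrow> real) \<Rightarrow> ('a \<Rightarrow> real) \<Rightarrow> real" where
  "correlation X Y = covariance X Y / sqrt (variance X * variance Y)"

definition square_integrable_process :: "(real \<Rightarrow> 'a \<Rightarrow> real) \<Rightarrow> bool" where
  "square_integrable_process X \<longleftrightarrow>
     (\<forall>t\<ge>0. random_variable borel (X t) \<and> integrable M (\<lambda>\<omega>. (X t \<omega>)\<^sup>2))"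

(* Stationarity in the wide sense; a square integrable process that is stationary in the strict
   sense is also stationary in this sense. *)
definition stationary_process :: "(real \<Rightarrow> 'a \<Rightarrow> real) \<Rightarrow> bool" where
  "stationary_process X \<longleftrightarrow>
     (\<forall>t\<ge>0. expectation (X t) = expectation (X 0)) \<and>
     (\<forall>t\<ge>0. \<forall>h\<ge>0. covariance (X t) (X (t + h)) = covariance (X 0) (X h))"

(* Square integrability makes the correlations meaningful: the Bochner integral is 0 for functions
   that are not integrable. *)
definition long_range_dependent :: "(real \<Rightarrow> 'a \<Rightarrow> real) \<Rightarrow> bool" where
  "long_range_dependent X \<longleftrightarrow>
     square_integrable_process X \<and> \<not> stationary_process X \<and>
     (\<exists>\<theta>. 0 < \<theta> \<and> \<theta> < 1 \<and>
        (\<forall>s>0. \<exists>c>0. (\<lambda>t. correlation (X s) (X t)) \<sim>[at_top] (\<lambda>t. c * t powr - \<theta>)))"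

(* The library's indep_var, for variables with values in two different types. *)
definition indep_rvs :: "'b measure \<Rightarrow> ('a \<Rightarrow> 'b) \<Rightarrow> 'c measure \<Rightarrow> ('a \<Rightarrow> 'c) \<Rightarrow> bool" where
  "indep_rvs S X T Y \<longleftrightarrow>
     random_variable S X \<and> random_variable T Y \<and>
     indep_set {X -` A \<inter> space M |A. A \<in> sets S} {Y -` B \<inter> space M |B. B \<in> sets T}"

end

(* Independence of processes is independence of their sample paths, as random elements of the
   product sigma-algebra over the time set [0,\<infinity>). *)
abbreviation path_space :: "'b measure \<Rightarrow> (real \<Rightarrow> 'b) measure" where
  "path_space N \<equiv> PiM {0..} (\<lambda>_. N)"

definition sample_path :: "(real \<Rightarrow> 'a \<Rightarrow> 'b) \<Rightarrow> 'a \<Rightarrow> real \<Rightarrow> 'b" where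
  "sample_path X \<omega> = (\<lambda>t\<in>{0..}. X t \<omega>)"

end

theory Submission
  imports Defs "HOL-Real_Asymp.Real_Asymp"
begin

text \<open>
  The processes \<open>M0\<close>, \<open>M\<close> and hence \<open>Z x = M (M0 x)\<close> satisfy, with suitable \<open>m\<close> and \<open>v\<close>,
  \<open>E (Z x) = m x\<close> and \<open>E (Z x Z y) = v min x y + m\<^sup>2 x y\<close>, and evaluating
  such a process at an independent random time keeps these formulas with \<open>x\<close>, \<open>y\<close> replaced by the
  expectations of the corresponding functions of the times. Hence for \<open>s \<le> t\<close> the covariance of the
  time-changed process is \<open>v E (Y s) + m\<^sup>2 Cov (Y s, Y t)\<close>, and everything reduces to \<open>Y\<close>.

  Scaling of the stable law gives \<open>E (Y t) = t\<^sup>\<alpha> E (Y 1)\<close> and \<open>E ((Y t)\<^sup>2) = t\<^sup>2\<^sup>\<alpha> E ((Y 1)\<^sup>2)\<close>. Since \<open>Y t > x\<close>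
  means \<open>D x \<le> t\<close> up to boundary cases, independence of the increments of \<open>D\<close> sandwiches
  \<open>E (Y s Y t) - E ((Y s)\<^sup>2) / 2 = \<integral>\<integral> P (x < Y s, x + z < Y t) dx dz\<close> between \<open>E (Y s) E (Y (t - s))\<close>
  and \<open>E (Y s) E (Y t)\<close>. As \<open>\<alpha> < 1\<close>, \<open>Cov (Y s, Y t)\<close> converges to \<open>E ((Y s)\<^sup>2) / 2\<close>, while the variance
  of the process grows like \<open>t\<^sup>2\<^sup>\<alpha>\<close>; the correlations therefore decay like \<open>t\<^sup>-\<^sup>\<alpha>\<close>.
\<close>

text \<open>Only the Laplace transform of \<open>D\<close> is known, and no law is inverted:
  \<open>exp (- D x \<omega>)\<close> lies in [0,1] almost surely and is determined by its moments,
  which are Laplace transforms at integers. Nor is the law of \<open>Y\<close> identified. Events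
  about \<open>D\<close> lie between strict and weak events about \<open>Y\<close>, and integrals
  over the levels give the same value for both, so identities for \<open>Y\<close> come from pairs
  of inequalities. The counting processes are controlled at fixed times only: their monotonicity has
  a null set that depends on the times, and paths are merely right-continuous. A random time is
  therefore rounded up to a dyadic grid, where countably many cases remain, and the rounding is
  removed by dominated convergence. Formulas with \<open>min x y\<close> survive composition because
  the minimum commutes with an almost surely monotone time change. The term v E(Y t) contributes
  only order t^\<alpha> to the variance; that the true order is t^(2 \<alpha>) rests on
  \<open>Y 1\<close> having positive variance, which needs its own argument.\<close>

section \<open>Scaling of stable subordinators\<close>

context prob_space
begin

text \<open>Weierstrass: on [0,1] a continuous function is uniformly close to polynomials, and
  expectations of polynomials are combinations of moments.\<close>

lemma expectation_continuous_eq_of_moments_eq: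
  fixes A B :: "'a \<Rightarrow> real" and f :: "real \<Rightarrow> real"
  assumes mA[measurable]: "random_variable borel A" and mB[measurable]: "random_variable borel B"
    and A01: "AE \<omega> in M. A \<omega> \<in> {0..1}" and B01: "AE \<omega> in M. B \<omega> \<in> {0..1}"
    and mom: "\<And>n::nat. expectation (\<lambda>\<omega>. A \<omega> ^ n) = expectation (\<lambda>\<omega>. B \<omega> ^ n)"
    and f: "continuous_on UNIV f"
  shows "expectation (\<lambda>\<omega>. f (A \<omega>)) = expectation (\<lambda>\<omega>. f (B \<omega>))"
proof -
  have f01: "continuous_on {0..1} f"
    using f continuous_on_subset by blast
  have mf[measurable]: "f \<in> borel_measurable borel"
    using f by (rule borel_measurable_continuous_onI)
  obtain C where C: "\<forall>x\<in>{0..1}. \<bar>f x\<bar> \<le> C"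
    using compact_imp_bounded[OF compact_continuous_image[OF f01 compact_Icc]]
    by (auto simp: bounded_iff)
  have int_f: "integrable M (\<lambda>\<omega>. f (X \<omega>))"
    if [measurable]: "random_variable borel X" and "AE \<omega> in M. X \<omega> \<in> {0..1}" for X
    using that(2) by (intro integrable_const_bound[where B=C]) (use C in auto)
  have int_pow: "integrable M (\<lambda>\<omega>. X \<omega> ^ n)"
    if [measurable]: "random_variable borel X" and "AE \<omega> in M. X \<omega> \<in> {0..1}" for X :: "'a \<Rightarrow> real" and n
    using that(2) by (intro integrable_const_bound[where B=1]) (auto simp: power_le_one)
  have "\<bar>expectation (\<lambda>\<omega>. f (A \<omega>)) - expectation (\<lambda>\<omega>. f (B \<omega>))\<bar> \<le> 0 + e" if "e > 0" for e
  proof -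
    obtain g where g: "real_polynomial_function g" "\<And>x. x \<in> {0..1} \<Longrightarrow> \<bar>f x - g x\<bar> < e / 2"
      using Stone_Weierstrass_real_polynomial_function[OF compact_Icc f01, of "e / 2"] \<open>e > 0\<close> by auto
    obtain a N where g_eq: "g = (\<lambda>x. \<Sum>i\<le>N. a i * x ^ i)"
      using g(1) unfolding real_polynomial_function_iff_sum by blast
    have eq_g: "expectation (\<lambda>\<omega>. g (A \<omega>)) = expectation (\<lambda>\<omega>. g (B \<omega>))"
      unfolding g_eq using int_pow[OF mA A01] int_pow[OF mB B01]
      by (subst (1 2) Bochner_Integration.integral_sum) (auto simp: mom)
    have close: "\<bar>expectation (\<lambda>\<omega>. f (X \<omega>)) - expectation (\<lambda>\<omega>. g (X \<omega>))\<bar> \<le> e / 2"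
      if mX: "random_variable borel X" and X01: "AE \<omega> in M. X \<omega> \<in> {0..1}" for X
    proof -
      note ints = int_f[OF mX X01] int_pow[OF mX X01]
      have int_g: "integrable M (\<lambda>\<omega>. g (X \<omega>))"
        unfolding g_eq using ints by simp
      have "\<bar>expectation (\<lambda>\<omega>. f (X \<omega>)) - expectation (\<lambda>\<omega>. g (X \<omega>))\<bar>
          = \<bar>expectation (\<lambda>\<omega>. f (X \<omega>) - g (X \<omega>))\<bar>"
        using ints int_g by simp
      also have "\<dots> \<le> expectation (\<lambda>\<omega>. \<bar>f (X \<omega>) - g (X \<omega>)\<bar>)"
        by (rule integral_abs_bound)
      also have "\<dots> \<le> expectation (\<lambda>\<omega>. e / 2)"
        using X01 g(2) ints int_g by (intro integral_mono_AE) (auto intro: less_imp_le)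
      finally show ?thesis by (simp add: prob_space)
    qed
    show ?thesis
      using close[OF mA A01] close[OF mB B01] eq_g by linarith
  qed
  then have "\<bar>expectation (\<lambda>\<omega>. f (A \<omega>)) - expectation (\<lambda>\<omega>. f (B \<omega>))\<bar> \<le> 0"
    by (rule field_le_epsilon)
  then show ?thesis by simp
qed

text \<open>The indicator of \<open>{a..}\<close> is a pointwise limit of continuous ramps, to which
  the moment comparison applies; dominated convergence carries the equality over.\<close>

lemma prob_ge_eq_of_moments_eq:
  fixes A B :: "'a \<Rightarrow> real"
  assumes mA[measurable]: "random_variable borel A" and mB[measurable]: "random_variable borel B"
    and A01: "AE \<omega> in M. A \<omega> \<in> {0..1}" and B01: "AE \<omega> in M. B \<omega> \<in> {0..1}"
    and mom: "\<And>n::nat. expectation (\<lambda>\<omega>. A \<omega> ^ n) = expectation (\<lambda>\<omega>. B \<omega> ^ n)"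
  shows "\<P>(\<omega> in M. a \<le> A \<omega>) = \<P>(\<omega> in M. a \<le> B \<omega>)"
proof -
  \<comment> \<open>For n > 0 the ramp is 1 on \<open>{a..}\<close> and falls to 0 within 1/n to its
    left, so the limit is correct at \<open>a\<close> itself and atoms do no harm.\<close>
  define f where "f n x = min 1 (max 0 (1 - real n * (a - x)))" for n x
  have cont: "continuous_on UNIV (f n)" for n
    unfolding f_def by (intro continuous_intros)
  have mf[measurable]: "f n \<in> borel_measurable borel" for n
    using cont by (rule borel_measurable_continuous_onI)
  have lim_f: "(\<lambda>n. f n x) \<longlonglongrightarrow> indicator {a..} x" for x
  proof (cases "a \<le> x")
    case True
    then have nonpos: "real n * (a - x) \<le> 0" for n
      by (simp add: mult_nonneg_nonpos)
    have "f n x = 1" for n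
      using nonpos[of n] unfolding f_def by simp
    then show ?thesis using True by simp
  next
    case False
    then have "filterlim (\<lambda>n. real n * (a - x)) at_top sequentially"
      by real_asymp
    then have "eventually (\<lambda>n. real n * (a - x) \<ge> 1) sequentially"
      by (simp add: filterlim_at_top)
    then have "eventually (\<lambda>n. f n x = indicator {a..} x) sequentially"
      by eventually_elim (use False in \<open>auto simp: f_def\<close>)
    then show ?thesis by (rule tendsto_eventually)
  qed
  have lim: "(\<lambda>n. expectation (\<lambda>\<omega>. f n (X \<omega>))) \<longlonglongrightarrow> \<P>(\<omega> in M. a \<le> X \<omega>)"
    if [measurable]: "random_variable borel X" for X
  proof -
    have "(\<lambda>n. expectation (\<lambda>\<omega>. f n (X \<omega>))) \<longlonglongrightarrow> expectation (\<lambda>\<omega>. indicator {a..} (X \<omega>))"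
      by (rule integral_dominated_convergence[where w="\<lambda>_. 1"]) (auto simp: lim_f, auto simp: f_def)
    also have "expectation (\<lambda>\<omega>. indicator {a..} (X \<omega>)) = expectation (indicator {\<omega>\<in>space M. a \<le> X \<omega>})"
      by (intro Bochner_Integration.integral_cong) (auto simp: indicator_def)
    also have "\<dots> = \<P>(\<omega> in M. a \<le> X \<omega>)" by simp
    finally show ?thesis .
  qed
  have "expectation (\<lambda>\<omega>. f n (A \<omega>)) = expectation (\<lambda>\<omega>. f n (B \<omega>))" for n
    by (rule expectation_continuous_eq_of_moments_eq[OF mA mB A01 B01 mom cont])
  then show ?thesis
    using LIMSEQ_unique[OF lim[OF mA]] lim[OF mB] by simp
qed

lemma stable_subordinatorD:
  assumes "stable_subordinator \<alpha> D"
  shows "0 \<le> t \<Longrightarrow> random_variable borel (D t)"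
    and "AE \<omega> in M. D 0 \<omega> = 0"
    and "\<omega> \<in> space M \<Longrightarrow> 0 \<le> x \<Longrightarrow> x \<le> y \<Longrightarrow> D x \<omega> \<le> D y \<omega>"
    and "0 \<le> t \<Longrightarrow> 0 < s \<Longrightarrow> expectation (\<lambda>\<omega>. exp (- s * D t \<omega>)) = exp (- t * s powr \<alpha>)"
    and "independent_increments D" "stationary_increments D"
  using assms mono_onD[of "{0..}" "\<lambda>t. D t \<omega>" x y]
  unfolding stable_subordinator_def levy_process_def by auto

lemma stable_subordinator_nonneg:
  assumes "stable_subordinator \<alpha> D" "0 \<le> t"
  shows "AE \<omega> in M. 0 \<le> D t \<omega>"
  using stable_subordinatorD(2)[OF assms(1)] AE_space
  by eventually_elim (use stable_subordinatorD(3)[OF assms(1), of _ 0 t] assms(2) in fastforce)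

text \<open>With b = c^(1/\<alpha>), the n-th moments of exp(-D(c x)) and exp(-b D(x)) are Laplace
  transforms at n and at n b. Both equal exp(-c x n^\<alpha>), because b^\<alpha> = c.\<close>

lemma stable_subordinator_scaling:
  assumes D: "stable_subordinator \<alpha> D" and "\<alpha> > 0" "c > 0" "x \<ge> 0"
  shows "\<P>(\<omega> in M. D (c * x) \<omega> \<le> c powr (1 / \<alpha>) * t) = \<P>(\<omega> in M. D x \<omega> \<le> t)"
proof -
  define b where "b = c powr (1 / \<alpha>)"
  have b: "b > 0" "b powr \<alpha> = c"
    using assms by (simp_all add: b_def powr_powr)
  have [measurable]: "random_variable borel (D x)" "random_variable borel (D (c * x))"
    using assms by (auto intro: stable_subordinatorD(1))
  have mom: "expectation (\<lambda>\<omega>. exp (- D (c * x) \<omega>) ^ n) = expectation (\<lambda>\<omega>. exp (- b * D x \<omega>) ^ n)" for n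
  proof (cases "n = 0")
    \<comment> \<open>The zeroth moment is treated apart because the Laplace formula speaks of
      positive arguments only.\<close>
    case False
    have "expectation (\<lambda>\<omega>. exp (- D (c * x) \<omega>) ^ n) = expectation (\<lambda>\<omega>. exp (- real n * D (c * x) \<omega>))"
      by (simp flip: exp_of_nat_mult)
    also have "\<dots> = exp (- (c * x) * real n powr \<alpha>)"
      using False assms by (intro stable_subordinatorD(4)[OF D]) auto
    also have "\<dots> = exp (- x * (real n * b) powr \<alpha>)"
      using b by (simp add: powr_mult)
    also have "\<dots> = expectation (\<lambda>\<omega>. exp (- (real n * b) * D x \<omega>))"
      using False assms b by (intro stable_subordinatorD(4)[OF D, symmetric]) auto
    also have "\<dots> = expectation (\<lambda>\<omega>. exp (- b * D x \<omega>) ^ n)"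
      by (simp add: mult.assoc flip: exp_of_nat_mult)
    finally show ?thesis .
  qed auto
  have "\<P>(\<omega> in M. exp (- b * t) \<le> exp (- D (c * x) \<omega>)) = \<P>(\<omega> in M. exp (- b * t) \<le> exp (- b * D x \<omega>))"
  proof (rule prob_ge_eq_of_moments_eq[OF _ _ _ _ mom])
    show "AE \<omega> in M. exp (- D (c * x) \<omega>) \<in> {0..1}"
      using stable_subordinator_nonneg[OF D, of "c * x"] assms by auto
    show "AE \<omega> in M. exp (- b * D x \<omega>) \<in> {0..1}"
      using stable_subordinator_nonneg[OF D, of x] assms b by auto
  qed measurable
  then show ?thesis using b by (simp add: b_def)
qed

end

section \<open>Tail integrals and the inverse subordinator\<close>

context prob_space
begin

lemma independent_increments_indep_var:
  assumes "independent_increments X" "0 \<le> r" "r < s" "s < t"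
  shows "indep_var borel (\<lambda>\<omega>. X s \<omega> - X r \<omega>) borel (\<lambda>\<omega>. X t \<omega> - X s \<omega>)"
proof -
  define p :: "nat \<Rightarrow> real" where "p = (\<lambda>i. if i = 0 then r else if i = 1 then s else t)"
  have "indep_vars (\<lambda>_. borel) (\<lambda>i \<omega>. X (p (Suc i)) \<omega> - X (p i) \<omega>) {..<2}"
    using assms(1)[unfolded independent_increments_def, rule_format, of p 2] assms(2-)
    by (auto simp: p_def)
  from indep_var_compose[OF indep_var_restrict[OF this, of "{0}" "{1}"],
      of "\<lambda>f. f 0" borel "\<lambda>f. f 1" borel]
  show ?thesis
    by (auto simp: p_def comp_def)
qed

text \<open>Both sides are the product measure of the set of pairs satisfying \<open>Q\<close>,
  computed by sections in the two orders. This yields layer-cake formulas over \<open>lborel\<close>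
  and over its square.\<close>

lemma nn_integral_emeasure_swap:
  assumes "sigma_finite_measure N"
    and [measurable]: "Measurable.pred (N \<Otimes>\<^sub>M M) (\<lambda>p. Q (fst p) (snd p))"
  shows "(\<integral>\<^sup>+x. emeasure M {\<omega>\<in>space M. Q x \<omega>} \<partial>N) = (\<integral>\<^sup>+\<omega>. emeasure N {x\<in>space N. Q x \<omega>} \<partial>M)"
proof -
  interpret N: sigma_finite_measure N by fact
  interpret pair_sigma_finite N M ..
  define E where "E = {p\<in>space (N \<Otimes>\<^sub>M M). Q (fst p) (snd p)}"
  have [measurable]: "E \<in> sets (N \<Otimes>\<^sub>M M)"
    unfolding E_def by measurable
  have meas: "case_prod (\<lambda>x \<omega>. indicator E (x, \<omega>) :: ennreal) \<in> borel_measurable (N \<Otimes>\<^sub>M M)"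
    by (simp add: case_prod_eta)
  have 1: "emeasure M {\<omega>\<in>space M. Q x \<omega>} = (\<integral>\<^sup>+\<omega>. indicator E (x, \<omega>) \<partial>M)" if "x \<in> space N" for x
  proof -
    have "(\<integral>\<^sup>+\<omega>. indicator E (x, \<omega>) \<partial>M) = (\<integral>\<^sup>+\<omega>. indicator (Pair x -` E) \<omega> \<partial>M)"
      by (intro nn_integral_cong) (auto simp: indicator_def)
    also have "\<dots> = emeasure M (Pair x -` E)"
      by (rule nn_integral_indicator) (rule sets_Pair1, measurable)
    also have "Pair x -` E = {\<omega>\<in>space M. Q x \<omega>}"
      using that by (auto simp: E_def space_pair_measure)
    finally show ?thesis by simp
  qed
  have 2: "emeasure N {x\<in>space N. Q x \<omega>} = (\<integral>\<^sup>+x. indicator E (x, \<omega>) \<partial>N)" if "\<omega> \<in> space M" for \<omega>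
  proof -
    have "(\<integral>\<^sup>+x. indicator E (x, \<omega>) \<partial>N) = (\<integral>\<^sup>+x. indicator ((\<lambda>x. (x, \<omega>)) -` E) x \<partial>N)"
      by (intro nn_integral_cong) (auto simp: indicator_def)
    also have "\<dots> = emeasure N ((\<lambda>x. (x, \<omega>)) -` E)"
      by (rule nn_integral_indicator) (rule sets_Pair2, measurable)
    also have "(\<lambda>x. (x, \<omega>)) -` E = {x\<in>space N. Q x \<omega>}"
      using that by (auto simp: E_def space_pair_measure)
    finally show ?thesis by simp
  qed
  have "(\<integral>\<^sup>+x. emeasure M {\<omega>\<in>space M. Q x \<omega>} \<partial>N) = (\<integral>\<^sup>+x. (\<integral>\<^sup>+\<omega>. indicator E (x, \<omega>) \<partial>M) \<partial>N)"
    by (intro nn_integral_cong) (simp add: 1)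
  also have "\<dots> = (\<integral>\<^sup>+\<omega>. (\<integral>\<^sup>+x. indicator E (x, \<omega>) \<partial>N) \<partial>M)"
    by (rule Fubini'[OF meas, symmetric])
  also have "\<dots> = (\<integral>\<^sup>+\<omega>. emeasure N {x\<in>space N. Q x \<omega>} \<partial>M)"
    by (intro nn_integral_cong) (simp add: 2)
  finally show ?thesis .
qed

text \<open>Layer cake: for fixed \<omega> the admissible levels form an interval from 0 to
  \<open>A \<omega>\<close>. Its length ignores the right endpoint, and it is empty for negative
  \<open>A \<omega>\<close>, in line with the truncation by \<open>ennreal\<close>.\<close>

lemma nn_integral_tail:
  fixes A :: "'a \<Rightarrow> real"
  assumes [measurable]: "random_variable borel A"
  shows "(\<integral>\<^sup>+x. emeasure M {\<omega>\<in>space M. 0 < x \<and> x < A \<omega>} \<partial>lborel) = (\<integral>\<^sup>+\<omega>. ennreal (A \<omega>) \<partial>M)"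
    and "(\<integral>\<^sup>+x. emeasure M {\<omega>\<in>space M. 0 < x \<and> x \<le> A \<omega>} \<partial>lborel) = (\<integral>\<^sup>+\<omega>. ennreal (A \<omega>) \<partial>M)"
proof -
  have tail: "emeasure lborel {x. 0 < x \<and> x < a} = ennreal a" (is "?L a")
    "emeasure lborel {x. 0 < x \<and> x \<le> a} = ennreal a" (is "?R a") for a :: real
  proof -
    have sets: "{x. 0 < x \<and> x < a} = {0<..<a}" "{x. 0 < x \<and> x \<le> a} = {0<..a}" by auto
    have "emeasure lborel {0<..<a} = ennreal a" "emeasure lborel {0<..a} = ennreal a"
      by (cases "0 \<le> a"; simp add: ennreal_neg)+
    then show "?L a" "?R a" by (simp_all only: sets)
  qed
  show "(\<integral>\<^sup>+x. emeasure M {\<omega>\<in>space M. 0 < x \<and> x < A \<omega>} \<partial>lborel) = (\<integral>\<^sup>+\<omega>. ennreal (A \<omega>) \<partial>M)"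
    using nn_integral_emeasure_swap[of lborel "\<lambda>x \<omega>. 0 < x \<and> x < A \<omega>", OF lborel.sigma_finite_measure_axioms]
    by (simp add: tail)
  show "(\<integral>\<^sup>+x. emeasure M {\<omega>\<in>space M. 0 < x \<and> x \<le> A \<omega>} \<partial>lborel) = (\<integral>\<^sup>+\<omega>. ennreal (A \<omega>) \<partial>M)"
    using nn_integral_emeasure_swap[of lborel "\<lambda>x \<omega>. 0 < x \<and> x \<le> A \<omega>", OF lborel.sigma_finite_measure_axioms]
    by (simp add: tail)
qed

text \<open>A strict tail on the left against a weak one on the right is exactly the comparison that
  the detour from \<open>Y\<close> through \<open>D\<close> provides; the layer-cake integrals do
  not distinguish the two kinds of tail.\<close>

lemma nn_integral_le_of_tail_le:
  fixes A B :: "'a \<Rightarrow> real"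
  assumes [measurable]: "random_variable borel A" "random_variable borel B"
    and le: "\<And>x. 0 < x \<Longrightarrow> \<P>(\<omega> in M. x < A \<omega>) \<le> \<P>(\<omega> in M. x \<le> B \<omega>)"
  shows "(\<integral>\<^sup>+\<omega>. ennreal (A \<omega>) \<partial>M) \<le> (\<integral>\<^sup>+\<omega>. ennreal (B \<omega>) \<partial>M)"
proof -
  have "(\<integral>\<^sup>+x. emeasure M {\<omega>\<in>space M. 0 < x \<and> x < A \<omega>} \<partial>lborel)
      \<le> (\<integral>\<^sup>+x. emeasure M {\<omega>\<in>space M. 0 < x \<and> x \<le> B \<omega>} \<partial>lborel)"
  proof (rule nn_integral_mono)
    fix x :: real
    show "emeasure M {\<omega>\<in>space M. 0 < x \<and> x < A \<omega>} \<le> emeasure M {\<omega>\<in>space M. 0 < x \<and> x \<le> B \<omega>}"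
      using le[of x] by (cases "0 < x") (simp_all add: emeasure_eq_measure)
  qed
  then show ?thesis by (simp add: nn_integral_tail)
qed

end

text \<open>The section at x has length b - x, so the area is the integral of b - x over [0,a]. It
  is used with \<open>a = Y s \<omega>\<close> and \<open>b = Y t \<omega>\<close>; the second
  coordinate is the gap between two levels, which lets increments of \<open>D\<close> enter.\<close>

lemma emeasure_lborel_staircase:
  fixes a b :: real
  assumes "0 \<le> a" "a \<le> b"
  shows "emeasure (lborel \<Otimes>\<^sub>M lborel) {p. 0 < fst p \<and> fst p < a \<and> 0 < snd p \<and> fst p + snd p < b} = ennreal (a * b - a\<^sup>2 / 2)" (is ?A)
    and "emeasure (lborel \<Otimes>\<^sub>M lborel) {p. 0 < fst p \<and> fst p \<le> a \<and> 0 < snd p \<and> fst p + snd p \<le> b} = ennreal (a * b - a\<^sup>2 / 2)" (is ?B)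
proof -
  have int: "(\<integral>\<^sup>+x. ennreal (b - x) * indicator {0..a} x \<partial>lborel) = ennreal (a * b - a\<^sup>2 / 2)"
  proof -
    have deriv: "((\<lambda>x. b * x - x\<^sup>2 / 2) has_real_derivative b - x) (at x)" for x
      by (rule derivative_eq_intros refl | simp)+
    have "(\<integral>\<^sup>+x. ennreal (b - x) * indicator {0..a} x \<partial>lborel)
        = ennreal ((b * a - a\<^sup>2 / 2) - (b * 0 - 0\<^sup>2 / 2))"
      by (rule nn_integral_FTC_Icc) (use assms deriv in \<open>auto intro: has_field_derivative_at_within\<close>)
    then show ?thesis by (simp add: mult.commute)
  qed
  have ae: "AE x in lborel. x \<noteq> 0 \<and> x \<noteq> a" for a :: real
    by (auto intro!: AE_conjI AE_lborel_singleton)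
  define S where "S = {p :: real \<times> real. 0 < fst p \<and> fst p < a \<and> 0 < snd p \<and> fst p + snd p < b}"
  define T where "T = {p :: real \<times> real. 0 < fst p \<and> fst p \<le> a \<and> 0 < snd p \<and> fst p + snd p \<le> b}"
  have "Measurable.pred (borel \<Otimes>\<^sub>M borel) (\<lambda>p. p \<in> S)" "Measurable.pred (borel \<Otimes>\<^sub>M borel) (\<lambda>p. p \<in> T)"
    unfolding S_def T_def mem_Collect_eq by measurable
  then have S: "S \<in> sets (lborel \<Otimes>\<^sub>M lborel)" and T: "T \<in> sets (lborel \<Otimes>\<^sub>M lborel)"
    by (simp_all add: pred_def space_pair_measure cong: sets_pair_measure_cong)
  have secS: "Pair x -` S = (if 0 < x \<and> x < a then {0<..<b - x} else {})" for x
    by (auto simp: S_def)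
  have secT: "Pair x -` T = (if 0 < x \<and> x \<le> a then {0<..b - x} else {})" for x
    by (auto simp: T_def)
  have "emeasure (lborel \<Otimes>\<^sub>M lborel) S = (\<integral>\<^sup>+x. emeasure lborel (Pair x -` S) \<partial>lborel)"
    by (rule lborel.emeasure_pair_measure_alt[OF S])
  also have "\<dots> = (\<integral>\<^sup>+x. ennreal (b - x) * indicator {0..a} x \<partial>lborel)"
  proof (rule nn_integral_cong_AE)
    \<comment> \<open>The two functions differ at most at x = 0 and x = a.\<close>
    show "AE x in lborel. emeasure lborel (Pair x -` S) = ennreal (b - x) * indicator {0..a} x"
      using ae[of a] by eventually_elim (use assms in \<open>auto simp: secS indicator_def\<close>)
  qed
  finally show ?A unfolding int S_def .
  have "emeasure (lborel \<Otimes>\<^sub>M lborel) T = (\<integral>\<^sup>+x. emeasure lborel (Pair x -` T) \<partial>lborel)"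
    by (rule lborel.emeasure_pair_measure_alt[OF T])
  also have "\<dots> = (\<integral>\<^sup>+x. ennreal (b - x) * indicator {0..a} x \<partial>lborel)"
  proof (rule nn_integral_cong_AE)
    show "AE x in lborel. emeasure lborel (Pair x -` T) = ennreal (b - x) * indicator {0..a} x"
      using ae[of a] by eventually_elim (use assms in \<open>auto simp: secT indicator_def\<close>)
  qed
  finally show ?B unfolding int T_def .
qed

section \<open>Comparison of the inverse with the paths of the subordinator\<close>

locale stable_inverse = prob_space M for M :: "'a measure" +
  fixes \<alpha> :: real and D Y :: "real \<Rightarrow> 'a \<Rightarrow> real"
  assumes index_pos: "0 < \<alpha>"
    and stable: "stable_subordinator \<alpha> D"
    and Y_eq: "\<And>t \<omega>. 0 \<le> t \<Longrightarrow> \<omega> \<in> space M \<Longrightarrow>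
           Y t \<omega> = (if \<exists>x>0. t < D x \<omega> then Inf {x. 0 < x \<and> t < D x \<omega>} else 0)"
    and Y_measurable: "\<And>t. 0 \<le> t \<Longrightarrow> random_variable borel (Y t)"
begin

lemmas D_measurable = stable_subordinatorD(1)[OF stable]
lemmas D_zero = stable_subordinatorD(2)[OF stable]
lemmas D_mono = stable_subordinatorD(3)[OF stable]
lemmas D_laplace = stable_subordinatorD(4)[OF stable]
lemmas D_nonneg = stable_subordinator_nonneg[OF stable]

text \<open>If \<open>t < D x \<omega>\<close>, then \<open>x\<close> is a passage time and the
  infimum is at most \<open>x\<close>. This holds on every path: without any passage
  \<open>Y t \<omega>\<close> is 0, which the assumptions exclude.\<close>

lemma D_le_of_less_Y:
  assumes "0 \<le> t" "\<omega> \<in> space M" "0 < x" "x < Y t \<omega>"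
  shows "D x \<omega> \<le> t"
proof (rule ccontr)
  assume "\<not> D x \<omega> \<le> t"
  then have "x \<in> {x. 0 < x \<and> t < D x \<omega>}" using assms by simp
  moreover have "bdd_below {x. 0 < x \<and> t < D x \<omega>}"
    by (rule bdd_belowI[of _ 0]) auto
  ultimately have "Inf {x. 0 < x \<and> t < D x \<omega>} \<le> x" by (rule cInf_lower)
  then show False using assms Y_eq[of t \<omega>] by (auto split: if_splits)
qed

lemma Y_nonneg:
  assumes "0 \<le> t" "\<omega> \<in> space M"
  shows "0 \<le> Y t \<omega>"
proof (cases "\<exists>x>0. t < D x \<omega>")
  case True
  then have "0 \<le> Inf {x. 0 < x \<and> t < D x \<omega>}"
    by (intro cInf_greatest) auto
  then show ?thesis using True by (simp add: Y_eq[OF assms])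
next
  case False
  then show ?thesis by (simp only: Y_eq[OF assms] if_False)
qed

text \<open>By monotonicity of \<open>D\<close> no passage time lies before \<open>x\<close>. The
  assumption \<open>ex\<close> rules out the default value 0. The conclusion is weak because passage
  may occur immediately after \<open>x\<close>.\<close>

lemma le_Y_of_D_le:
  assumes "0 \<le> t" "\<omega> \<in> space M" "0 \<le> x" "D x \<omega> \<le> t" and ex: "\<exists>y>0. t < D y \<omega>"
  shows "x \<le> Y t \<omega>"
proof -
  have "x \<le> y" if "0 < y" "t < D y \<omega>" for y
    using D_mono[of \<omega> y x] that assms by force
  then show ?thesis
    using ex by (simp add: Y_eq[OF assms(1,2)]) (intro cInf_greatest, auto)
qed

text \<open>Markov's inequality for \<open>exp (- D x \<omega>)\<close>.\<close>

lemma prob_D_le: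
  assumes "0 \<le> x"
  shows "\<P>(\<omega> in M. D x \<omega> \<le> t) \<le> exp (t - x)"
proof -
  note D_measurable[OF assms, measurable]
  have E: "expectation (\<lambda>\<omega>. exp (- D x \<omega>)) = exp (- x)"
    using D_laplace[of x 1] assms by simp
  \<comment> \<open>A function that is not integrable has Bochner integral 0, whereas this value is
    positive.\<close>
  then have int: "integrable M (\<lambda>\<omega>. exp (- D x \<omega>))"
    using not_integrable_integral_eq by fastforce
  have "\<P>(\<omega> in M. D x \<omega> \<le> t) = expectation (indicator {\<omega>\<in>space M. D x \<omega> \<le> t})"
    by simp
  also have "\<dots> \<le> expectation (\<lambda>\<omega>. exp t * exp (- D x \<omega>))"
    using int by (intro integral_mono integrable_mult_right)
      (auto simp: indicator_def less_top[symmetric] emeasure_eq_measure simp flip: exp_add)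
  also have "\<dots> = exp t * exp (- x)"
    using int by (simp only: integral_mult_right_zero E)
  also have "\<dots> = exp (t - x)"
    by (simp flip: exp_add)
  finally show ?thesis .
qed

text \<open>Being bounded by m at all positive integers has probability at most exp(m - n - 1) for
  every n, hence 0. The union over natural m is one null event that serves all \<open>t\<close>, and
  off it the passage times are never empty.\<close>

lemma AE_D_unbounded: "AE \<omega> in M. \<forall>t. \<exists>x>0. t < D x \<omega>"
proof -
  have "AE \<omega> in M. \<exists>n. real m < D (real (Suc n)) \<omega>" for m :: nat
  proof -
    define N where "N = {\<omega>\<in>space M. \<forall>n. D (real (Suc n)) \<omega> \<le> real m}"
    note D_measurable[of "real (Suc n)" for n, simplified, measurable]
    have [measurable]: "N \<in> events" unfolding N_def by simp
    have "prob N \<le> exp (real m - real (Suc n))" for n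
    proof -
      have "prob N \<le> \<P>(\<omega> in M. D (real (Suc n)) \<omega> \<le> real m)"
        by (rule finite_measure_mono) (auto simp: N_def)
      also have "\<dots> \<le> exp (real m - real (Suc n))"
        by (rule prob_D_le) simp
      finally show ?thesis .
    qed
    moreover have "(\<lambda>n. exp (real m - real (Suc n))) \<longlonglongrightarrow> 0"
      by real_asymp
    ultimately have "prob N \<le> 0"
      by (intro LIMSEQ_le_const) auto
    then have "N \<in> null_sets M"
      by (simp add: null_sets_def emeasure_eq_measure measure_le_0_iff)
    then show ?thesis
      by (rule AE_I') (auto simp: N_def not_less)
  qed
  then have "AE \<omega> in M. \<forall>m. \<exists>n. real m < D (real (Suc n)) \<omega>"
    by (simp add: AE_all_countable)
  then show ?thesis
  proof eventually_elim
    case (elim \<omega>)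
    show ?case
    proof
      fix t
      obtain m where m: "t < real m"
        using reals_Archimedean2 by blast
      obtain n where "real m < D (real (Suc n)) \<omega>"
        using elim by blast
      with m have "0 < real (Suc n) \<and> t < D (real (Suc n)) \<omega>" by simp
      then show "\<exists>x>0. t < D x \<omega>" by blast
    qed
  qed
qed

text \<open>Only almost sure: on a path that passes \<open>s\<close> but never \<open>t\<close>, the
  default value makes \<open>Y t \<omega>\<close> zero while \<open>Y s \<omega>\<close> may be
  positive.\<close>

lemma AE_Y_mono:
  assumes "0 \<le> s" "s \<le> t"
  shows "AE \<omega> in M. Y s \<omega> \<le> Y t \<omega>"
  using AE_D_unbounded AE_space
proof eventually_elim
  case (elim \<omega>)
  have "x \<le> Y t \<omega>" if "0 < x" "x < Y s \<omega>" for x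
    using D_le_of_less_Y[of s \<omega> x] le_Y_of_D_le[of t \<omega> x] elim that assms by auto
  moreover have "0 \<le> Y t \<omega>"
    using Y_nonneg assms elim by simp
  ultimately show ?case
    by (cases "0 < Y s \<omega>") (auto intro: dense_le_bounded[of 0])
qed

text \<open>Together with the next lemma this encloses the event that \<open>D x\<close> is at most
  \<open>t\<close> between the strict and the weak tail event of \<open>Y t\<close>; the scaling of
  \<open>D\<close> reaches \<open>Y\<close> in this way.\<close>

lemma prob_less_Y_le:
  assumes "0 \<le> t" "0 < x"
  shows "\<P>(\<omega> in M. x < Y t \<omega>) \<le> \<P>(\<omega> in M. D x \<omega> \<le> t)"
proof (rule finite_measure_mono)
  show "{\<omega>\<in>space M. x < Y t \<omega>} \<subseteq> {\<omega>\<in>space M. D x \<omega> \<le> t}"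
    using D_le_of_less_Y[OF assms(1) _ assms(2)] by blast
  have [measurable]: "random_variable borel (D x)"
    using assms by (intro D_measurable) simp
  show "{\<omega>\<in>space M. D x \<omega> \<le> t} \<in> events" by measurable
qed

lemma prob_D_le_Y:
  assumes "0 \<le> t" "0 < x"
  shows "\<P>(\<omega> in M. D x \<omega> \<le> t) \<le> \<P>(\<omega> in M. x \<le> Y t \<omega>)"
proof (rule finite_measure_mono_AE)
  show "AE \<omega> in M. \<omega> \<in> {\<omega>\<in>space M. D x \<omega> \<le> t} \<longrightarrow> \<omega> \<in> {\<omega>\<in>space M. x \<le> Y t \<omega>}"
    using AE_D_unbounded by eventually_elim (use le_Y_of_D_le[OF assms(1) _ less_imp_le[OF assms(2)]] in blast)
  have [measurable]: "random_variable borel (Y t)"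
    using assms by (intro Y_measurable) simp
  show "{\<omega>\<in>space M. x \<le> Y t \<omega>} \<in> events" by measurable
qed

text \<open>The increments over [0,x] and [x,x+z] are independent, and stationarity replaces the
  second by one over [0,z]. As \<open>D 0\<close> vanishes only almost surely, each event has to be
  identified up to a null set.\<close>

lemma prob_D_increments:
  assumes "0 < x" "0 < z"
  shows "\<P>(\<omega> in M. D x \<omega> \<le> s \<and> D (x + z) \<omega> - D x \<omega> \<le> t)
       = \<P>(\<omega> in M. D x \<omega> \<le> s) * \<P>(\<omega> in M. D z \<omega> \<le> t)"
proof -
  have [measurable]: "random_variable borel (D 0)" "random_variable borel (D x)"
      "random_variable borel (D z)" "random_variable borel (D (x + z))"
    using D_measurable[of 0] D_measurable[of x] D_measurable[of z] D_measurable[of "x + z"] assms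
    by simp_all
  have ind: "indep_var borel (\<lambda>\<omega>. D x \<omega> - D 0 \<omega>) borel (\<lambda>\<omega>. D (x + z) \<omega> - D x \<omega>)"
    using independent_increments_indep_var[OF stable_subordinatorD(5)[OF stable], of 0 x "x + z"] assms
    by simp
  have eq: "distr M borel (\<lambda>\<omega>. D (x + z) \<omega> - D x \<omega>) = distr M borel (\<lambda>\<omega>. D z \<omega> - D 0 \<omega>)"
    using stable_subordinatorD(6)[OF stable] assms
    by (simp add: stationary_increments_def)
  have "\<P>(\<omega> in M. D x \<omega> \<le> s \<and> D (x + z) \<omega> - D x \<omega> \<le> t)
      = prob ((\<lambda>\<omega>. (D x \<omega> - D 0 \<omega>, D (x + z) \<omega> - D x \<omega>)) -` ({..s} \<times> {..t}) \<inter> space M)"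
  proof (rule finite_measure_eq_AE)
    show "AE \<omega> in M. \<omega> \<in> {\<omega>\<in>space M. D x \<omega> \<le> s \<and> D (x + z) \<omega> - D x \<omega> \<le> t}
        \<longleftrightarrow> \<omega> \<in> (\<lambda>\<omega>. (D x \<omega> - D 0 \<omega>, D (x + z) \<omega> - D x \<omega>)) -` ({..s} \<times> {..t}) \<inter> space M"
      using D_zero by eventually_elim auto
  qed measurable
  also have "\<dots> = prob ((\<lambda>\<omega>. D x \<omega> - D 0 \<omega>) -` {..s} \<inter> space M)
      * prob ((\<lambda>\<omega>. D (x + z) \<omega> - D x \<omega>) -` {..t} \<inter> space M)"
    by (rule indep_varD[OF ind]) auto
  also have "prob ((\<lambda>\<omega>. D x \<omega> - D 0 \<omega>) -` {..s} \<inter> space M) = \<P>(\<omega> in M. D x \<omega> \<le> s)"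
  proof (rule finite_measure_eq_AE)
    show "AE \<omega> in M. \<omega> \<in> (\<lambda>\<omega>. D x \<omega> - D 0 \<omega>) -` {..s} \<inter> space M
        \<longleftrightarrow> \<omega> \<in> {\<omega>\<in>space M. D x \<omega> \<le> s}"
      using D_zero by eventually_elim auto
  qed measurable
  also have "prob ((\<lambda>\<omega>. D (x + z) \<omega> - D x \<omega>) -` {..t} \<inter> space M)
      = prob ((\<lambda>\<omega>. D z \<omega> - D 0 \<omega>) -` {..t} \<inter> space M)"
    using arg_cong[OF eq, of "\<lambda>N. measure N {..t}"] by (simp add: measure_distr)
  also have "\<dots> = \<P>(\<omega> in M. D z \<omega> \<le> t)"
  proof (rule finite_measure_eq_AE)
    show "AE \<omega> in M. \<omega> \<in> (\<lambda>\<omega>. D z \<omega> - D 0 \<omega>) -` {..t} \<inter> space M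
        \<longleftrightarrow> \<omega> \<in> {\<omega>\<in>space M. D z \<omega> \<le> t}"
      using D_zero by eventually_elim auto
  qed measurable
  finally show ?thesis .
qed

end

section \<open>Moments of the inverse subordinator\<close>

context prob_space
begin

lemma borel_measurable_emeasure_section:
  assumes [measurable]: "Measurable.pred (N \<Otimes>\<^sub>M M) (\<lambda>p. Q (fst p) (snd p))"
  shows "(\<lambda>x. emeasure M {\<omega>\<in>space M. Q x \<omega>}) \<in> borel_measurable N"
proof -
  define E where "E = {p\<in>space (N \<Otimes>\<^sub>M M). Q (fst p) (snd p)}"
  have "E \<in> sets (N \<Otimes>\<^sub>M M)"
    unfolding E_def by measurable
  then have "(\<lambda>x. emeasure M (Pair x -` E)) \<in> borel_measurable N"
    by (rule measurable_emeasure_Pair)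
  moreover have "Pair x -` E = {\<omega>\<in>space M. Q x \<omega>}" if "x \<in> space N" for x
    using that by (auto simp: E_def space_pair_measure)
  ultimately show ?thesis by (subst (asm) measurable_cong) auto
qed

text \<open>Level x for the squares is level sqrt x for the variables.\<close>

lemma nn_integral_square_le_of_tail_le:
  fixes A B :: "'a \<Rightarrow> real"
  assumes [measurable]: "random_variable borel A" "random_variable borel B"
    and nonneg: "\<And>\<omega>. \<omega> \<in> space M \<Longrightarrow> 0 \<le> A \<omega>" "\<And>\<omega>. \<omega> \<in> space M \<Longrightarrow> 0 \<le> B \<omega>"
    and le: "\<And>x. 0 < x \<Longrightarrow> \<P>(\<omega> in M. x < A \<omega>) \<le> \<P>(\<omega> in M. x \<le> B \<omega>)"
  shows "(\<integral>\<^sup>+\<omega>. ennreal ((A \<omega>)\<^sup>2) \<partial>M) \<le> (\<integral>\<^sup>+\<omega>. ennreal ((B \<omega>)\<^sup>2) \<partial>M)"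
proof (rule nn_integral_le_of_tail_le)
  fix x :: real assume x: "0 < x"
  have sq: "x < a\<^sup>2 \<longleftrightarrow> sqrt x < a" "x \<le> a\<^sup>2 \<longleftrightarrow> sqrt x \<le> a" if "0 \<le> a" for a
    using real_sqrt_less_iff[of x "a\<^sup>2"] real_sqrt_le_iff[of x "a\<^sup>2"] that by simp_all
  have "{\<omega>\<in>space M. x < (A \<omega>)\<^sup>2} = {\<omega>\<in>space M. sqrt x < A \<omega>}"
    "{\<omega>\<in>space M. x \<le> (B \<omega>)\<^sup>2} = {\<omega>\<in>space M. sqrt x \<le> B \<omega>}"
    using nonneg sq by blast+
  then show "\<P>(\<omega> in M. x < (A \<omega>)\<^sup>2) \<le> \<P>(\<omega> in M. x \<le> (B \<omega>)\<^sup>2)"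
    using le[of "sqrt x"] x by simp
qed measurable

end

lemma nn_integral_mult_pair_lborel:
  fixes f g :: "real \<Rightarrow> ennreal"
  assumes [measurable]: "f \<in> borel_measurable borel" "g \<in> borel_measurable borel"
  shows "(\<integral>\<^sup>+p. f (fst p) * g (snd p) \<partial>(lborel \<Otimes>\<^sub>M lborel)) = (\<integral>\<^sup>+x. f x \<partial>lborel) * (\<integral>\<^sup>+x. g x \<partial>lborel)"
  by (subst lborel.nn_integral_fst[symmetric]) (simp_all add: nn_integral_cmult nn_integral_multc)

lemma integrable_mult_of_square_integrable:
  fixes f g :: "'a \<Rightarrow> real"
  assumes [measurable]: "f \<in> borel_measurable M" "g \<in> borel_measurable M"
    and "integrable M (\<lambda>x. (f x)\<^sup>2)" "integrable M (\<lambda>x. (g x)\<^sup>2)"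
  shows "integrable M (\<lambda>x. f x * g x)"
proof (rule Bochner_Integration.integrable_bound)
  show "integrable M (\<lambda>x. (f x)\<^sup>2 + (g x)\<^sup>2)" using assms by simp
  have "\<bar>a * b\<bar> \<le> a\<^sup>2 + b\<^sup>2" for a b :: real
    using sum_squares_bound[of "\<bar>a\<bar>" "\<bar>b\<bar>"] abs_ge_zero[of "a * b"]
    unfolding power2_abs abs_mult by linarith
  then show "AE x in M. norm (f x * g x) \<le> norm ((f x)\<^sup>2 + (g x)\<^sup>2)" by simp
qed measurable

context stable_inverse
begin

text \<open>The tail P(Y t > n) is at most exp(t - n), and the square of \<open>Y t\<close> is
  dominated by the sum of (n+1)^2 over all n below \<open>Y t\<close>, whose last term alone
  suffices.\<close>

lemma Y_square_integrable:
  assumes t: "0 \<le> t" shows "integrable M (\<lambda>\<omega>. (Y t \<omega>)\<^sup>2)"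
proof (rule integrableI_nonneg)
  note Y_measurable[OF t, measurable]
  show "(\<lambda>\<omega>. (Y t \<omega>)\<^sup>2) \<in> borel_measurable M" by measurable
  have tail: "emeasure M {\<omega>\<in>space M. real n < Y t \<omega>} \<le> ennreal (exp (t - real n))" for n
  proof (cases "n = 0")
    case True
    have "prob {\<omega>\<in>space M. real n < Y t \<omega>} \<le> 1" by simp
    also have "1 \<le> exp (t - real n)" using True t by simp
    finally show ?thesis by (simp add: emeasure_eq_measure)
  next
    case False
    then show ?thesis
      using order_trans[OF prob_less_Y_le[OF t, of "real n"] prob_D_le[of "real n" t]]
      by (simp add: emeasure_eq_measure)
  qed
  have "(\<integral>\<^sup>+\<omega>. ennreal ((Y t \<omega>)\<^sup>2) \<partial>M)
      \<le> (\<integral>\<^sup>+\<omega>. (\<Sum>n. ennreal ((real n + 1)\<^sup>2) * indicator {\<omega>\<in>space M. real n < Y t \<omega>} \<omega>) \<partial>M)"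
  proof (rule nn_integral_mono)
    fix \<omega> assume \<omega>: "\<omega> \<in> space M"
    define f :: "nat \<Rightarrow> ennreal"
      where "f n = ennreal ((real n + 1)\<^sup>2) * indicator {\<omega>\<in>space M. real n < Y t \<omega>} \<omega>" for n
    show "ennreal ((Y t \<omega>)\<^sup>2) \<le> (\<Sum>n. f n)"
    proof (cases "Y t \<omega> = 0")
      case False
      then have pos: "0 < Y t \<omega>" using Y_nonneg[OF t \<omega>] by simp
      \<comment> \<open>The last integer strictly below \<open>Y t \<omega>\<close>; ceiling minus
        one stays strict when the value is itself an integer.\<close>
      define n where "n = nat (\<lceil>Y t \<omega>\<rceil> - 1)"
      have n: "real n < Y t \<omega>" "Y t \<omega> \<le> real n + 1"
        using pos unfolding n_def by linarith+
      then have "ennreal ((Y t \<omega>)\<^sup>2) \<le> f n"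
        using \<omega> pos by (auto simp: f_def intro!: ennreal_leI power_mono)
      also have "f n \<le> (\<Sum>n. f n)"
        using sum_le_suminf[of f "{n}"] by simp
      finally show ?thesis .
    qed simp
  qed
  also have "\<dots> = (\<Sum>n. ennreal ((real n + 1)\<^sup>2) * emeasure M {\<omega>\<in>space M. real n < Y t \<omega>})"
    by (subst nn_integral_suminf) (simp_all add: nn_integral_cmult_indicator)
  also have "\<dots> \<le> (\<Sum>n. ennreal ((real n + 1)\<^sup>2 * exp (t - real n)))"
    using tail by (intro suminf_le) (auto simp: ennreal_mult intro!: mult_left_mono)
  also have "\<dots> = ennreal (\<Sum>n. (real n + 1)\<^sup>2 * exp (t - real n))"
  proof (rule suminf_ennreal2)
    show "summable (\<lambda>n. (real n + 1)\<^sup>2 * exp (t - real n))"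
    proof (rule summable_comparison_test_bigo)
      show "summable (\<lambda>n. norm (inverse (real n ^ 2)))"
        using inverse_power_summable[of 2, where ?'a=real] by simp
      show "(\<lambda>n. (real n + 1)\<^sup>2 * exp (t - real n)) \<in> O(\<lambda>n. inverse (real n ^ 2))"
        by real_asymp
    qed
  qed simp
  finally show "(\<integral>\<^sup>+\<omega>. ennreal ((Y t \<omega>)\<^sup>2) \<partial>M) < \<infinity>"
    by (rule le_less_trans) simp
qed simp

lemma Y_integrable: "0 \<le> t \<Longrightarrow> integrable M (Y t)"
  using square_integrable_imp_integrable Y_square_integrable Y_measurable by blast

lemma Y_mult_integrable: "0 \<le> s \<Longrightarrow> 0 \<le> t \<Longrightarrow> integrable M (\<lambda>\<omega>. Y s \<omega> * Y t \<omega>)"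
  by (intro integrable_mult_of_square_integrable Y_measurable Y_square_integrable)

lemma nn_integral_Y: "0 \<le> t \<Longrightarrow> (\<integral>\<^sup>+\<omega>. ennreal (Y t \<omega>) \<partial>M) = ennreal (expectation (Y t))"
  using Y_nonneg by (intro nn_integral_eq_integral Y_integrable AE_I2)

lemma expectation_Y_nonneg: "0 \<le> t \<Longrightarrow> 0 \<le> expectation (Y t)"
  using Y_nonneg by (intro integral_nonneg_AE AE_I2)

text \<open>For the time factor c = t^\<alpha> the space factor c^(1/\<alpha>) is \<open>t\<close>,
  so P(D(t^\<alpha> x) \<le> t) = P(D(x) \<le> 1). Enclosing both sides by tails of
  \<open>Y t\<close> and \<open>Y 1\<close> gives the two comparisons.\<close>

lemma tail_scaling:
  assumes t: "0 < t" and x: "0 < x"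
  shows "\<P>(\<omega> in M. t powr \<alpha> * x < Y t \<omega>) \<le> \<P>(\<omega> in M. x \<le> Y 1 \<omega>)"
    and "\<P>(\<omega> in M. x < Y 1 \<omega>) \<le> \<P>(\<omega> in M. t powr \<alpha> * x \<le> Y t \<omega>)"
proof -
  have "(t powr \<alpha>) powr (1 / \<alpha>) = t"
    using t index_pos by (simp add: powr_powr)
  then have eq: "\<P>(\<omega> in M. D (t powr \<alpha> * x) \<omega> \<le> t) = \<P>(\<omega> in M. D x \<omega> \<le> 1)"
    using stable_subordinator_scaling[OF stable index_pos, of "t powr \<alpha>" x 1] t x by simp
  show "\<P>(\<omega> in M. t powr \<alpha> * x < Y t \<omega>) \<le> \<P>(\<omega> in M. x \<le> Y 1 \<omega>)"
    using prob_less_Y_le[of t "t powr \<alpha> * x"] prob_D_le_Y[of 1 x] t x eq by simp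
  show "\<P>(\<omega> in M. x < Y 1 \<omega>) \<le> \<P>(\<omega> in M. t powr \<alpha> * x \<le> Y t \<omega>)"
    using prob_less_Y_le[of 1 x] prob_D_le_Y[of t "t powr \<alpha> * x"] t x eq by simp
qed

lemma
  assumes t: "0 < t"
  shows expectation_Y_scaling: "expectation (Y t) = t powr \<alpha> * expectation (Y 1)"
    and expectation_Y_square_scaling:
      "expectation (\<lambda>\<omega>. (Y t \<omega>)\<^sup>2) = t powr (2 * \<alpha>) * expectation (\<lambda>\<omega>. (Y 1 \<omega>)\<^sup>2)"
proof -
  define b where "b = t powr \<alpha>"
  define A where "A = (\<lambda>\<omega>. Y t \<omega> / b)"
  have b: "0 < b" using t by (simp add: b_def)
  have [measurable]: "random_variable borel (Y 1)" "random_variable borel A"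
    using Y_measurable[of t] Y_measurable[of 1] t by (simp_all add: A_def)
  have nonneg: "0 \<le> A \<omega>" "0 \<le> Y 1 \<omega>" if "\<omega> \<in> space M" for \<omega>
    using Y_nonneg[of t \<omega>] Y_nonneg[of 1 \<omega>] t b that by (simp_all add: A_def)
  have t1: "\<P>(\<omega> in M. x < A \<omega>) \<le> \<P>(\<omega> in M. x \<le> Y 1 \<omega>)" if "0 < x" for x
    using tail_scaling(1)[OF t that] b by (simp add: A_def b_def[symmetric] field_simps)
  have t2: "\<P>(\<omega> in M. x < Y 1 \<omega>) \<le> \<P>(\<omega> in M. x \<le> A \<omega>)" if "0 < x" for x
    using tail_scaling(2)[OF t that] b by (simp add: A_def b_def[symmetric] field_simps)
  have int: "integrable M A" "integrable M (\<lambda>\<omega>. (A \<omega>)\<^sup>2)" "integrable M (Y 1)" "integrable M (\<lambda>\<omega>. (Y 1 \<omega>)\<^sup>2)"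
    using Y_integrable[of t] Y_square_integrable[of t] Y_integrable[of 1] Y_square_integrable[of 1] t
    by (simp_all add: A_def power_divide)
  \<comment> \<open>The tails of \<open>A\<close> and \<open>Y 1\<close> interleave in both
    directions, so the integrals agree by antisymmetry.\<close>
  have "(\<integral>\<^sup>+\<omega>. ennreal (A \<omega>) \<partial>M) = (\<integral>\<^sup>+\<omega>. ennreal (Y 1 \<omega>) \<partial>M)"
    by (intro antisym nn_integral_le_of_tail_le t1 t2) measurable
  then have "expectation A = expectation (Y 1)"
    using int nonneg by (subst (asm) (1 2) nn_integral_eq_integral) (auto intro!: integral_nonneg_AE AE_I2)
  then show "expectation (Y t) = t powr \<alpha> * expectation (Y 1)"
    using b by (simp add: A_def b_def[symmetric] field_simps)
  have "(\<integral>\<^sup>+\<omega>. ennreal ((A \<omega>)\<^sup>2) \<partial>M) = (\<integral>\<^sup>+\<omega>. ennreal ((Y 1 \<omega>)\<^sup>2) \<partial>M)"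
    by (intro antisym nn_integral_square_le_of_tail_le t1 t2 nonneg) measurable
  then have "expectation (\<lambda>\<omega>. (A \<omega>)\<^sup>2) = expectation (\<lambda>\<omega>. (Y 1 \<omega>)\<^sup>2)"
    using int by (subst (asm) (1 2) nn_integral_eq_integral) auto
  moreover have "t powr (2 * \<alpha>) = b\<^sup>2"
    by (simp add: b_def power2_eq_square flip: powr_add)
  ultimately show "expectation (\<lambda>\<omega>. (Y t \<omega>)\<^sup>2) = t powr (2 * \<alpha>) * expectation (\<lambda>\<omega>. (Y 1 \<omega>)\<^sup>2)"
    using b by (simp add: A_def power_divide field_simps)
qed

lemma expectation_Y_product_bounds:
  assumes s: "0 \<le> s" and st: "s \<le> t"
  defines "I \<equiv> expectation (\<lambda>\<omega>. Y s \<omega> * Y t \<omega>) - expectation (\<lambda>\<omega>. (Y s \<omega>)\<^sup>2) / 2"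
  shows "expectation (Y s) * expectation (Y (t - s)) \<le> I" "I \<le> expectation (Y s) * expectation (Y t)"
proof -
  have t: "0 \<le> t" and ts: "0 \<le> t - s" using s st by auto
  note meas[measurable] = Y_measurable[OF s] Y_measurable[OF t] Y_measurable[OF ts]
  have int: "integrable M (\<lambda>\<omega>. Y s \<omega> * Y t \<omega> - (Y s \<omega>)\<^sup>2 / 2)"
    using Y_mult_integrable[OF s t] Y_square_integrable[OF s] by simp
  have AE_nonneg: "AE \<omega> in M. 0 \<le> Y s \<omega> * Y t \<omega> - (Y s \<omega>)\<^sup>2 / 2"
    using AE_Y_mono[OF s st] AE_space
  proof eventually_elim
    case (elim \<omega>)
    then have "Y s \<omega> * Y s \<omega> \<le> Y s \<omega> * Y t \<omega>"
      using Y_nonneg[OF s] by (intro mult_left_mono) auto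
    moreover have "0 \<le> Y s \<omega> * Y s \<omega>" by simp
    ultimately show ?case unfolding power2_eq_square by linarith
  qed
  have I: "I = expectation (\<lambda>\<omega>. Y s \<omega> * Y t \<omega> - (Y s \<omega>)\<^sup>2 / 2)"
    using Y_mult_integrable[OF s t] Y_square_integrable[OF s] by (simp add: I_def)
  have I_nonneg: "0 \<le> I"
    unfolding I using AE_nonneg by (rule integral_nonneg_AE)
  have nn_I: "(\<integral>\<^sup>+\<omega>. ennreal (Y s \<omega> * Y t \<omega> - (Y s \<omega>)\<^sup>2 / 2) \<partial>M) = ennreal I"
    unfolding I by (rule nn_integral_eq_integral[OF int AE_nonneg])
  \<comment> \<open>\<open>strict\<close> and \<open>weak\<close> express the same number
    \<open>I\<close>. The upper bound starts from strict inequalities, which imply statements about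
    \<open>D\<close>; the lower bound ends in weak ones, which statements about \<open>D\<close>
    imply.\<close>
  have strict: "(\<integral>\<^sup>+p. emeasure M {\<omega>\<in>space M. 0 < fst p \<and> fst p < Y s \<omega> \<and> 0 < snd p \<and> fst p + snd p < Y t \<omega>} \<partial>(lborel \<Otimes>\<^sub>M lborel))
      = ennreal I"
  proof -
    have "(\<integral>\<^sup>+\<omega>. emeasure (lborel \<Otimes>\<^sub>M lborel) {p. 0 < fst p \<and> fst p < Y s \<omega> \<and> 0 < snd p \<and> fst p + snd p < Y t \<omega>} \<partial>M) = ennreal I"
      unfolding nn_I[symmetric]
    proof (rule nn_integral_cong_AE)
      show "AE \<omega> in M. emeasure (lborel \<Otimes>\<^sub>M lborel) {p. 0 < fst p \<and> fst p < Y s \<omega> \<and> 0 < snd p \<and> fst p + snd p < Y t \<omega>}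
          = ennreal (Y s \<omega> * Y t \<omega> - (Y s \<omega>)\<^sup>2 / 2)"
        using AE_Y_mono[OF s st] AE_space
        by eventually_elim (rule emeasure_lborel_staircase(1)[OF Y_nonneg[OF s]])
    qed
    then show ?thesis
      using nn_integral_emeasure_swap[of "lborel \<Otimes>\<^sub>M lborel"
          "\<lambda>p \<omega>. 0 < fst p \<and> fst p < Y s \<omega> \<and> 0 < snd p \<and> fst p + snd p < Y t \<omega>",
          OF lborel_pair.sigma_finite_measure_axioms]
      by (simp add: space_pair_measure)
  qed
  have weak: "(\<integral>\<^sup>+p. emeasure M {\<omega>\<in>space M. 0 < fst p \<and> fst p \<le> Y s \<omega> \<and> 0 < snd p \<and> fst p + snd p \<le> Y t \<omega>} \<partial>(lborel \<Otimes>\<^sub>M lborel))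
      = ennreal I"
  proof -
    have "(\<integral>\<^sup>+\<omega>. emeasure (lborel \<Otimes>\<^sub>M lborel) {p. 0 < fst p \<and> fst p \<le> Y s \<omega> \<and> 0 < snd p \<and> fst p + snd p \<le> Y t \<omega>} \<partial>M) = ennreal I"
      unfolding nn_I[symmetric]
    proof (rule nn_integral_cong_AE)
      show "AE \<omega> in M. emeasure (lborel \<Otimes>\<^sub>M lborel) {p. 0 < fst p \<and> fst p \<le> Y s \<omega> \<and> 0 < snd p \<and> fst p + snd p \<le> Y t \<omega>}
          = ennreal (Y s \<omega> * Y t \<omega> - (Y s \<omega>)\<^sup>2 / 2)"
        using AE_Y_mono[OF s st] AE_space
        by eventually_elim (rule emeasure_lborel_staircase(2)[OF Y_nonneg[OF s]])
    qed
    then show ?thesis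
      using nn_integral_emeasure_swap[of "lborel \<Otimes>\<^sub>M lborel"
          "\<lambda>p \<omega>. 0 < fst p \<and> fst p \<le> Y s \<omega> \<and> 0 < snd p \<and> fst p + snd p \<le> Y t \<omega>",
          OF lborel_pair.sigma_finite_measure_axioms]
      by (simp add: space_pair_measure)
  qed
  have D_meas[measurable]: "random_variable borel (D x)" if "0 < x" for x
    using that by (intro D_measurable) simp
  \<comment> \<open>\<open>D (x + z) \<omega> \<le> t\<close> bounds the increment by
    \<open>t\<close> because \<open>D x \<omega>\<close> is nonnegative; discarding
    \<open>D x \<omega>\<close> is the loss on this side.\<close>
  have upper: "emeasure M {\<omega>\<in>space M. 0 < x \<and> x < Y s \<omega> \<and> 0 < z \<and> x + z < Y t \<omega>}
      \<le> emeasure M {\<omega>\<in>space M. 0 < x \<and> x \<le> Y s \<omega>} * emeasure M {\<omega>\<in>space M. 0 < z \<and> z \<le> Y t \<omega>}" for x z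
  proof (cases "0 < x \<and> 0 < z")
    case True
    then have xz: "0 < x" "0 < z" "0 < x + z" by auto
    note [measurable] = D_meas[OF xz(1)] D_meas[OF xz(2)] D_meas[OF xz(3)]
    have "\<P>(\<omega> in M. x < Y s \<omega> \<and> x + z < Y t \<omega>) \<le> \<P>(\<omega> in M. D x \<omega> \<le> s \<and> D (x + z) \<omega> - D x \<omega> \<le> t)"
    proof (rule finite_measure_mono_AE)
      show "AE \<omega> in M. \<omega> \<in> {\<omega>\<in>space M. x < Y s \<omega> \<and> x + z < Y t \<omega>}
          \<longrightarrow> \<omega> \<in> {\<omega>\<in>space M. D x \<omega> \<le> s \<and> D (x + z) \<omega> - D x \<omega> \<le> t}"
        using D_nonneg[OF less_imp_le[OF xz(1)]]
      proof eventually_elim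
        case (elim \<omega>)
        then show ?case
          using D_le_of_less_Y[OF s, of \<omega> x] D_le_of_less_Y[OF t, of \<omega> "x + z"] xz by force
      qed
    qed measurable
    also have "\<dots> = \<P>(\<omega> in M. D x \<omega> \<le> s) * \<P>(\<omega> in M. D z \<omega> \<le> t)"
      by (rule prob_D_increments) (use xz in auto)
    also have "\<dots> \<le> \<P>(\<omega> in M. x \<le> Y s \<omega>) * \<P>(\<omega> in M. z \<le> Y t \<omega>)"
      using s t xz by (intro mult_mono prob_D_le_Y) auto
    finally show ?thesis
      using xz by (simp add: emeasure_eq_measure flip: ennreal_mult')
  qed auto
  \<comment> \<open>\<open>D x \<omega> \<le> s\<close> and an increment of at most
    \<open>t - s\<close> force \<open>D (x + z) \<omega> \<le> t\<close>; reserving all of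
    \<open>s\<close> is the loss on this side.\<close>
  have lower: "emeasure M {\<omega>\<in>space M. 0 < x \<and> x < Y s \<omega>} * emeasure M {\<omega>\<in>space M. 0 < z \<and> z < Y (t - s) \<omega>}
      \<le> emeasure M {\<omega>\<in>space M. 0 < x \<and> x \<le> Y s \<omega> \<and> 0 < z \<and> x + z \<le> Y t \<omega>}" for x z
  proof (cases "0 < x \<and> 0 < z")
    case True
    then have xz: "0 < x" "0 < z" "0 < x + z" by auto
    note [measurable] = D_meas[OF xz(1)] D_meas[OF xz(2)] D_meas[OF xz(3)]
    have "\<P>(\<omega> in M. x < Y s \<omega>) * \<P>(\<omega> in M. z < Y (t - s) \<omega>)
        \<le> \<P>(\<omega> in M. D x \<omega> \<le> s) * \<P>(\<omega> in M. D z \<omega> \<le> t - s)"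
      using s ts xz by (intro mult_mono prob_less_Y_le) auto
    also have "\<dots> = \<P>(\<omega> in M. D x \<omega> \<le> s \<and> D (x + z) \<omega> - D x \<omega> \<le> t - s)"
      by (rule prob_D_increments[symmetric]) (use xz in auto)
    also have "\<dots> \<le> \<P>(\<omega> in M. x \<le> Y s \<omega> \<and> x + z \<le> Y t \<omega>)"
    proof (rule finite_measure_mono_AE)
      show "AE \<omega> in M. \<omega> \<in> {\<omega>\<in>space M. D x \<omega> \<le> s \<and> D (x + z) \<omega> - D x \<omega> \<le> t - s}
          \<longrightarrow> \<omega> \<in> {\<omega>\<in>space M. x \<le> Y s \<omega> \<and> x + z \<le> Y t \<omega>}"
        using AE_D_unbounded
      proof eventually_elim
        case (elim \<omega>)
        then have ex: "\<exists>x>0. s < D x \<omega>" "\<exists>x>0. t < D x \<omega>" by blast+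
        show ?case
          using le_Y_of_D_le[OF s _ _ _ ex(1), of x] le_Y_of_D_le[OF t _ _ _ ex(2), of "x + z"] xz by force
      qed
    qed measurable
    finally show ?thesis
      using xz by (simp add: emeasure_eq_measure flip: ennreal_mult')
  qed auto
  have m1: "(\<lambda>x. emeasure M {\<omega>\<in>space M. 0 < x \<and> x \<le> Y r \<omega>}) \<in> borel_measurable borel"
      "(\<lambda>x. emeasure M {\<omega>\<in>space M. 0 < x \<and> x < Y r \<omega>}) \<in> borel_measurable borel" if "0 \<le> r" for r
  proof -
    note [measurable] = Y_measurable[OF that]
    show "(\<lambda>x. emeasure M {\<omega>\<in>space M. 0 < x \<and> x \<le> Y r \<omega>}) \<in> borel_measurable borel"
      by (rule borel_measurable_emeasure_section) measurable
    show "(\<lambda>x. emeasure M {\<omega>\<in>space M. 0 < x \<and> x < Y r \<omega>}) \<in> borel_measurable borel"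
      by (rule borel_measurable_emeasure_section) measurable
  qed
  have "ennreal I \<le> (\<integral>\<^sup>+p. emeasure M {\<omega>\<in>space M. 0 < fst p \<and> fst p \<le> Y s \<omega>}
      * emeasure M {\<omega>\<in>space M. 0 < snd p \<and> snd p \<le> Y t \<omega>} \<partial>(lborel \<Otimes>\<^sub>M lborel))"
    unfolding strict[symmetric] by (rule nn_integral_mono) (rule upper)
  also have "\<dots> = ennreal (expectation (Y s)) * ennreal (expectation (Y t))"
    by (subst nn_integral_mult_pair_lborel[OF m1(1)[OF s] m1(1)[OF t]])
      (simp only: nn_integral_tail(2)[OF meas(1)] nn_integral_tail(2)[OF meas(2)] nn_integral_Y s t)
  finally show "I \<le> expectation (Y s) * expectation (Y t)"
    using expectation_Y_nonneg[OF s] expectation_Y_nonneg[OF t] by (simp flip: ennreal_mult)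
  have "ennreal (expectation (Y s)) * ennreal (expectation (Y (t - s)))
      = (\<integral>\<^sup>+p. emeasure M {\<omega>\<in>space M. 0 < fst p \<and> fst p < Y s \<omega>}
      * emeasure M {\<omega>\<in>space M. 0 < snd p \<and> snd p < Y (t - s) \<omega>} \<partial>(lborel \<Otimes>\<^sub>M lborel))"
    by (subst nn_integral_mult_pair_lborel[OF m1(2)[OF s] m1(2)[OF ts]])
      (simp only: nn_integral_tail(1)[OF meas(1)] nn_integral_tail(1)[OF meas(3)] nn_integral_Y s ts)
  also have "\<dots> \<le> ennreal I"
    unfolding weak[symmetric] by (rule nn_integral_mono) (rule lower)
  finally show "expectation (Y s) * expectation (Y (t - s)) \<le> I"
    using expectation_Y_nonneg[OF s] expectation_Y_nonneg[OF ts] I_nonneg by (simp flip: ennreal_mult)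
qed

lemma tendsto_covariance_Y:
  assumes "\<alpha> < 1" "0 < s"
  shows "((\<lambda>t. expectation (\<lambda>\<omega>. Y s \<omega> * Y t \<omega>) - expectation (Y s) * expectation (Y t))
      \<longlongrightarrow> expectation (\<lambda>\<omega>. (Y s \<omega>)\<^sup>2) / 2) at_top"
proof -
  define V where "V = expectation (\<lambda>\<omega>. (Y s \<omega>)\<^sup>2) / 2"
  define u where "u = expectation (Y s) * expectation (Y 1)"
  show ?thesis unfolding V_def[symmetric]
  proof (rule tendsto_sandwich[where h="\<lambda>_. V" and f="\<lambda>t. V + u * ((t - s) powr \<alpha> - t powr \<alpha>)"])
    show "((\<lambda>t. V) \<longlongrightarrow> V) at_top" by simp
    \<comment> \<open>The difference is asymptotic to -\<alpha> s t^(\<alpha> - 1), which vanishes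
      in the limit because \<open>\<alpha> < 1\<close>.\<close>
    have "((\<lambda>t. (t - s) powr \<alpha> - t powr \<alpha>) \<longlongrightarrow> 0) at_top"
      using assms index_pos by real_asymp
    then have "((\<lambda>t. V + u * ((t - s) powr \<alpha> - t powr \<alpha>)) \<longlongrightarrow> V + u * 0) at_top"
      by (intro tendsto_intros)
    then show "((\<lambda>t. V + u * ((t - s) powr \<alpha> - t powr \<alpha>)) \<longlongrightarrow> V) at_top" by simp
    show "\<forall>\<^sub>F t in at_top. expectation (\<lambda>\<omega>. Y s \<omega> * Y t \<omega>) - expectation (Y s) * expectation (Y t) \<le> V"
      using eventually_ge_at_top[of s]
      by eventually_elim (use expectation_Y_product_bounds(2)[of s] assms in \<open>force simp: V_def\<close>)
    show "\<forall>\<^sub>F t in at_top. V + u * ((t - s) powr \<alpha> - t powr \<alpha>)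
        \<le> expectation (\<lambda>\<omega>. Y s \<omega> * Y t \<omega>) - expectation (Y s) * expectation (Y t)"
      using eventually_gt_at_top[of s]
    proof eventually_elim
      case (elim t)
      have "u * ((t - s) powr \<alpha> - t powr \<alpha>)
          = expectation (Y s) * expectation (Y (t - s)) - expectation (Y s) * expectation (Y t)"
        using elim assms expectation_Y_scaling[of t] expectation_Y_scaling[of "t - s"]
        by (simp add: u_def algebra_simps)
      then show ?case
        using expectation_Y_product_bounds(1)[of s t] elim assms by (simp add: V_def)
    qed
  qed
qed

text \<open>If the mean were 0, then \<open>Y 1\<close> would vanish and \<open>D (1 / 2)\<close>
  exceed 1 almost surely, so E exp(-D(1/2)) would be at most exp(-1). It equals exp(-1/2). The level
  1/2 stands for any number strictly between 0 and 1.\<close>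

lemma expectation_Y_pos: "0 < expectation (Y 1)"
proof (rule ccontr)
  assume "\<not> 0 < expectation (Y 1)"
  then have "expectation (Y 1) = 0" using expectation_Y_nonneg[of 1] by simp
  then have zero: "AE \<omega> in M. Y 1 \<omega> = 0"
    using integral_nonneg_eq_0_iff_AE[OF Y_integrable[of 1]] Y_nonneg by auto
  have large: "AE \<omega> in M. exp (- 1 * D (1 / 2) \<omega>) \<le> exp (- 1)"
    using zero AE_D_unbounded AE_space
  proof eventually_elim
    case (elim \<omega>)
    have "\<not> D (1 / 2) \<omega> \<le> 1"
      using le_Y_of_D_le[of 1 \<omega> "1 / 2"] elim by auto
    then show ?case by simp
  qed
  have E: "expectation (\<lambda>\<omega>. exp (- 1 * D (1 / 2) \<omega>)) = exp (- (1 / 2))"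
    using D_laplace[of "1 / 2" 1] by simp
  then have "integrable M (\<lambda>\<omega>. exp (- 1 * D (1 / 2) \<omega>))"
    using not_integrable_integral_eq by fastforce
  then have "expectation (\<lambda>\<omega>. exp (- 1 * D (1 / 2) \<omega>)) \<le> expectation (\<lambda>\<omega>. exp (- 1))"
    using large by (intro integral_mono_AE) auto
  then show False
    unfolding E by (simp add: prob_space)
qed

text \<open>If the variance vanished, scaling would make every \<open>Y t\<close> constant, and the covariances could
  not converge to half of a positive second moment.\<close>

lemma variance_Y_pos:
  assumes "\<alpha> < 1"
  shows "(expectation (Y 1))\<^sup>2 < expectation (\<lambda>\<omega>. (Y 1 \<omega>)\<^sup>2)"
proof (rule ccontr)
  assume not: "\<not> ?thesis"
  have var: "variance (Y t) = expectation (\<lambda>\<omega>. (Y t \<omega>)\<^sup>2) - (expectation (Y t))\<^sup>2" if "0 \<le> t" for t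
    by (intro variance_eq Y_integrable Y_square_integrable that)
  have "0 \<le> variance (Y 1)" by simp
  with not var[of 1] have eq: "expectation (\<lambda>\<omega>. (Y 1 \<omega>)\<^sup>2) = (expectation (Y 1))\<^sup>2" by simp
  have prod: "expectation (\<lambda>\<omega>. Y 1 \<omega> * Y t \<omega>) - expectation (Y 1) * expectation (Y t) = 0" if t: "0 < t" for t
  proof -
    have "t powr (2 * \<alpha>) = (t powr \<alpha>)\<^sup>2"
      by (simp add: power2_eq_square flip: powr_add)
    then have "variance (Y t) = 0"
      using t var[of t] expectation_Y_scaling[OF t] expectation_Y_square_scaling[OF t] eq
      by (simp add: power_mult_distrib)
    moreover have "integrable M (\<lambda>\<omega>. (Y t \<omega> - expectation (Y t))\<^sup>2)"
      using Y_integrable[of t] Y_square_integrable[of t] t by (simp add: power2_diff)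
    ultimately have "AE \<omega> in M. Y t \<omega> = expectation (Y t)"
      using integral_nonneg_eq_0_iff_AE[of M "\<lambda>\<omega>. (Y t \<omega> - expectation (Y t))\<^sup>2"] by simp
    then have "expectation (\<lambda>\<omega>. Y 1 \<omega> * Y t \<omega>) = expectation (\<lambda>\<omega>. Y 1 \<omega> * expectation (Y t))"
      using Y_measurable[of 1] Y_measurable[of t] t
      by (intro integral_cong_AE) (auto elim!: eventually_mono)
    then show ?thesis by simp
  qed
  have "\<forall>\<^sub>F t in at_top. expectation (\<lambda>\<omega>. Y 1 \<omega> * Y t \<omega>) - expectation (Y 1) * expectation (Y t) = 0"
    using eventually_gt_at_top[of 0] by eventually_elim (rule prod)
  then have "((\<lambda>t. expectation (\<lambda>\<omega>. Y 1 \<omega> * Y t \<omega>) - expectation (Y 1) * expectation (Y t)) \<longlongrightarrow> 0) at_top"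
    by (rule tendsto_eventually)
  from tendsto_unique[OF _ this tendsto_covariance_Y[OF assms, of 1]]
  have "expectation (\<lambda>\<omega>. (Y 1 \<omega>)\<^sup>2) = 0" by simp
  with eq expectation_Y_pos show False by simp
qed

end

section \<open>Evaluation at an independent random time\<close>

context prob_space
begin

lemma indep_rvs_compose:
  assumes "indep_rvs S X T Y" "f \<in> S \<rightarrow>\<^sub>M S'" "g \<in> T \<rightarrow>\<^sub>M T'"
  shows "indep_rvs S' (\<lambda>\<omega>. f (X \<omega>)) T' (\<lambda>\<omega>. g (Y \<omega>))"
proof -
  have rv: "random_variable S X" "random_variable T Y"
    and ind: "indep_set {X -` A \<inter> space M |A. A \<in> sets S} {Y -` B \<inter> space M |B. B \<in> sets T}"
    using assms(1) by (auto simp: indep_rvs_def)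
  have fX: "(\<lambda>\<omega>. f (X \<omega>)) -` A \<inter> space M \<in> {X -` A \<inter> space M |A. A \<in> sets S}" if "A \<in> sets S'" for A
    using measurable_sets[OF assms(2) that] measurable_space[OF rv(1)]
    by (auto intro!: exI[of _ "f -` A \<inter> space S"])
  have gY: "(\<lambda>\<omega>. g (Y \<omega>)) -` B \<inter> space M \<in> {Y -` B \<inter> space M |B. B \<in> sets T}" if "B \<in> sets T'" for B
    using measurable_sets[OF assms(3) that] measurable_space[OF rv(2)]
    by (auto intro!: exI[of _ "g -` B \<inter> space T"])
  have rv': "random_variable S' (\<lambda>\<omega>. f (X \<omega>))" "random_variable T' (\<lambda>\<omega>. g (Y \<omega>))"
    using measurable_compose[OF rv(1) assms(2)] measurable_compose[OF rv(2) assms(3)] .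
  show ?thesis
    unfolding indep_rvs_def
  proof (intro conjI rv' indep_setI)
    fix a b
    assume "a \<in> {(\<lambda>\<omega>. f (X \<omega>)) -` A \<inter> space M |A. A \<in> sets S'}"
      and "b \<in> {(\<lambda>\<omega>. g (Y \<omega>)) -` B \<inter> space M |B. B \<in> sets T'}"
    then obtain A B where "A \<in> sets S'" "a = (\<lambda>\<omega>. f (X \<omega>)) -` A \<inter> space M"
      "B \<in> sets T'" "b = (\<lambda>\<omega>. g (Y \<omega>)) -` B \<inter> space M" by blast
    then show "prob (a \<inter> b) = prob a * prob b"
      using indep_setD[OF ind fX gY] by simp
  qed (use measurable_sets[OF rv'(1)] measurable_sets[OF rv'(2)] in blast)+
qed

text \<open>The families of preimages are closed under intersection, so their independence extends
  to the generated sigma-algebras, in terms of which \<open>indep_var\<close> is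
  characterized.\<close>

lemma indep_rvs_imp_indep_var:
  assumes "indep_rvs S X T Y"
  shows "indep_var S X T Y"
proof -
  have "Int_stable {X -` A \<inter> space M |A. A \<in> sets S}" for X :: "'a \<Rightarrow> 'b" and S :: "'b measure"
  proof (rule Int_stableI)
    fix a b assume "a \<in> {X -` A \<inter> space M |A. A \<in> sets S}" "b \<in> {X -` A \<inter> space M |A. A \<in> sets S}"
    then obtain A B where "A \<in> sets S" "a = X -` A \<inter> space M" "B \<in> sets S" "b = X -` B \<inter> space M"
      by blast
    then have "A \<inter> B \<in> sets S" "a \<inter> b = X -` (A \<inter> B) \<inter> space M" by auto
    then show "a \<inter> b \<in> {X -` A \<inter> space M |A. A \<in> sets S}" by blast
  qed
  then show ?thesis
    using assms indep_set_sigma_sets unfolding indep_rvs_def indep_var_eq by blast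
qed

lemma indep_var_nn_integral_mult:
  fixes X Y :: "'a \<Rightarrow> ennreal"
  assumes "indep_var borel X borel Y"
  shows "(\<integral>\<^sup>+\<omega>. X \<omega> * Y \<omega> \<partial>M) = (\<integral>\<^sup>+\<omega>. X \<omega> \<partial>M) * (\<integral>\<^sup>+\<omega>. Y \<omega> \<partial>M)"
proof -
  have eq: "case_bool borel borel = (\<lambda>_. borel)"
    by (auto split: bool.split)
  have "indep_vars (\<lambda>_. borel) (case_bool X Y) UNIV"
    using assms unfolding indep_var_def eq .
  from indep_vars_nn_integral[OF _ this] show ?thesis
    by (simp add: UNIV_bool mult.commute)
qed

text \<open>Decompose by the value of \<open>K\<close>: where it equals k the integrand is
  \<open>W k\<close>, and the hypothesis replaces \<open>W k\<close> by the constant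
  \<open>w k\<close>. The sum over values is an integral over \<open>count_space UNIV\<close>, so it
  can be exchanged with the expectation.\<close>

lemma nn_integral_countable_mixture:
  fixes K :: "'a \<Rightarrow> 'i::countable" and W :: "'i \<Rightarrow> 'a \<Rightarrow> ennreal"
  assumes [measurable]: "random_variable (count_space UNIV) K" "\<And>k. random_variable borel (W k)"
    and indep: "\<And>k. (\<integral>\<^sup>+\<omega>. indicator {k} (K \<omega>) * W k \<omega> \<partial>M) = (\<integral>\<^sup>+\<omega>. indicator {k} (K \<omega>) \<partial>M) * w k"
  shows "(\<integral>\<^sup>+\<omega>. W (K \<omega>) \<omega> \<partial>M) = (\<integral>\<^sup>+\<omega>. w (K \<omega>) \<partial>M)"
proof -
  have pick: "f j = (\<integral>\<^sup>+k. indicator {k} j * f k \<partial>count_space UNIV)" for f :: "'i \<Rightarrow> ennreal" and j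
  proof -
    have "(\<integral>\<^sup>+k. indicator {k} j * f k \<partial>count_space UNIV) = (\<integral>\<^sup>+k. f k * indicator {j} k \<partial>count_space UNIV)"
      by (intro nn_integral_cong) (auto simp: indicator_def)
    then show ?thesis by simp
  qed
  have "(\<integral>\<^sup>+\<omega>. W (K \<omega>) \<omega> \<partial>M) = (\<integral>\<^sup>+\<omega>. (\<integral>\<^sup>+k. indicator {k} (K \<omega>) * W k \<omega> \<partial>count_space UNIV) \<partial>M)"
    by (intro nn_integral_cong) (rule pick)
  also have "\<dots> = (\<integral>\<^sup>+k. (\<integral>\<^sup>+\<omega>. indicator {k} (K \<omega>) * W k \<omega> \<partial>M) \<partial>count_space UNIV)"
    by (rule nn_integral_count_space_nn_integral) auto
  also have "\<dots> = (\<integral>\<^sup>+k. (\<integral>\<^sup>+\<omega>. indicator {k} (K \<omega>) * w k \<partial>M) \<partial>count_space UNIV)"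
    by (rule nn_integral_cong) (simp add: indep nn_integral_multc)
  also have "\<dots> = (\<integral>\<^sup>+\<omega>. (\<integral>\<^sup>+k. indicator {k} (K \<omega>) * w k \<partial>count_space UNIV) \<partial>M)"
    by (rule nn_integral_count_space_nn_integral[symmetric]) auto
  also have "\<dots> = (\<integral>\<^sup>+\<omega>. w (K \<omega>) \<partial>M)"
    by (intro nn_integral_cong) (rule pick[symmetric])
  finally show ?thesis .
qed

end

text \<open>For \<open>x \<ge> 0\<close> the least point of the grid of mesh 2^-n strictly above
  \<open>x\<close>. Floor plus one replaces the ceiling because right limits see only times greater
  than \<open>x\<close>, even if \<open>x\<close> is a grid point. The natural numerator exhibits
  the countable range.\<close>

definition dyadic_above :: "nat \<Rightarrow> real \<Rightarrow> real" where
  "dyadic_above n x = (real (nat \<lfloor>2 ^ n * x\<rfloor>) + 1) / 2 ^ n"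

lemma dyadic_above_gt: "x < dyadic_above n x"
proof -
  have "2 ^ n * x < real (nat \<lfloor>2 ^ n * x\<rfloor>) + 1" by linarith
  then show ?thesis by (simp add: dyadic_above_def field_simps)
qed

lemma dyadic_above_le:
  assumes "0 \<le> x" shows "dyadic_above n x \<le> x + 1 / 2 ^ n"
proof -
  have "0 \<le> 2 ^ n * x" using assms by simp
  then have "real (nat \<lfloor>2 ^ n * x\<rfloor>) \<le> 2 ^ n * x" by linarith
  then show ?thesis by (simp add: dyadic_above_def field_simps)
qed

text \<open>The integer following \<open>x\<close> lies on every finer grid, so the next point of
  that grid comes no later. Level 0 thereby dominates all levels and supplies the majorant for
  dominated convergence.\<close>

lemma dyadic_above_le_0:
  assumes "0 \<le> x" shows "dyadic_above n x \<le> dyadic_above 0 x"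
proof -
  have "x < real_of_int (\<lfloor>x\<rfloor> + 1)"
    by linarith
  then have "2 ^ n * x < 2 ^ n * real_of_int (\<lfloor>x\<rfloor> + 1)"
    by (rule mult_strict_left_mono) simp
  then have "2 ^ n * x < real_of_int (2 ^ n * (\<lfloor>x\<rfloor> + 1))"
    by simp
  then have "\<lfloor>2 ^ n * x\<rfloor> + 1 \<le> 2 ^ n * (\<lfloor>x\<rfloor> + 1)"
    unfolding floor_less_iff[symmetric] by linarith
  then have "real_of_int (\<lfloor>2 ^ n * x\<rfloor> + 1) \<le> real_of_int (2 ^ n * (\<lfloor>x\<rfloor> + 1))"
    by (simp only: of_int_le_iff)
  then show ?thesis using assms
    by (simp add: dyadic_above_def field_simps)
qed

lemma dyadic_above_tendsto:
  assumes "0 \<le> x" shows "(\<lambda>n. dyadic_above n x) \<longlonglongrightarrow> x"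
proof (rule tendsto_sandwich[OF always_eventually always_eventually tendsto_const])
  show "(\<lambda>n. x + 1 / 2 ^ n) \<longlonglongrightarrow> x" by real_asymp
qed (use dyadic_above_gt dyadic_above_le assms in \<open>auto intro: less_imp_le\<close>)

lemma dyadic_above_borel[measurable]: "dyadic_above n \<in> borel_measurable borel"
  unfolding dyadic_above_def[abs_def] by measurable

context prob_space
begin

text \<open>At rounded times the expectation is a countable mixture and independence evaluates it.
  Refining the grid, right limits give convergence on every path, hence also measurability at the
  random time. Two time arguments let one result cover means and mixed moments.\<close>

lemma
  fixes W :: "real \<Rightarrow> real \<Rightarrow> 'a \<Rightarrow> real" and S T :: "'a \<Rightarrow> real" and w :: "real \<Rightarrow> real \<Rightarrow> real"
  assumes W_meas: "\<And>x y. 0 \<le> x \<Longrightarrow> 0 \<le> y \<Longrightarrow> random_variable borel (W x y)"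
    and W_lim: "\<And>x y p q \<omega>. \<omega> \<in> space M \<Longrightarrow> 0 \<le> x \<Longrightarrow> 0 \<le> y \<Longrightarrow> p \<longlonglongrightarrow> x \<Longrightarrow> q \<longlonglongrightarrow> y \<Longrightarrow>
        (\<forall>n. x < p n) \<Longrightarrow> (\<forall>n. y < q n) \<Longrightarrow> (\<lambda>n::nat. W (p n) (q n) \<omega>) \<longlonglongrightarrow> W x y \<omega>"
    and W_mono: "\<And>x y x' y'. 0 \<le> x \<Longrightarrow> x \<le> x' \<Longrightarrow> 0 \<le> y \<Longrightarrow> y \<le> y' \<Longrightarrow> AE \<omega> in M. W x y \<omega> \<le> W x' y' \<omega>"
    and W_mean: "\<And>x y. 0 \<le> x \<Longrightarrow> 0 \<le> y \<Longrightarrow> (\<integral>\<^sup>+\<omega>. ennreal (W x y \<omega>) \<partial>M) = ennreal (w x y)"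
    and w_cont: "continuous_on UNIV (\<lambda>z. w (fst z) (snd z))"
    and w_mono: "\<And>x y x' y'. 0 \<le> x \<Longrightarrow> x \<le> x' \<Longrightarrow> 0 \<le> y \<Longrightarrow> y \<le> y' \<Longrightarrow> w x y \<le> w x' y'"
    and fin: "(\<integral>\<^sup>+\<omega>. ennreal (w (S \<omega> + 1) (T \<omega> + 1)) \<partial>M) < \<infinity>"
    and ST_meas[measurable]: "random_variable borel S" "random_variable borel T"
    and ST_nonneg: "\<And>\<omega>. \<omega> \<in> space M \<Longrightarrow> 0 \<le> S \<omega>" "\<And>\<omega>. \<omega> \<in> space M \<Longrightarrow> 0 \<le> T \<omega>"
    and indep: "\<And>x y. 0 \<le> x \<Longrightarrow> 0 \<le> y \<Longrightarrow> indep_rvs (borel \<Otimes>\<^sub>M borel) (\<lambda>\<omega>. (S \<omega>, T \<omega>)) borel (W x y)"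
  shows random_time_measurable: "random_variable borel (\<lambda>\<omega>. W (S \<omega>) (T \<omega>) \<omega>)"
    and nn_integral_random_time: "(\<integral>\<^sup>+\<omega>. ennreal (W (S \<omega>) (T \<omega>) \<omega>) \<partial>M) = (\<integral>\<^sup>+\<omega>. ennreal (w (S \<omega>) (T \<omega>)) \<partial>M)"
proof -
  define g :: "nat \<Rightarrow> nat \<Rightarrow> real" where "g n i = (real i + 1) / 2 ^ n" for n i
  have g_nonneg: "0 \<le> g n i" for n i by (simp add: g_def)
  define K where "K n \<omega> = (nat \<lfloor>2 ^ n * S \<omega>\<rfloor>, nat \<lfloor>2 ^ n * T \<omega>\<rfloor>)" for n \<omega>
  have [measurable]: "random_variable (count_space UNIV) (K n)" for n
  proof -
    have "K n = (\<lambda>\<omega>. (nat \<lfloor>2 ^ n * S \<omega>\<rfloor>, nat \<lfloor>2 ^ n * T \<omega>\<rfloor>))" by (auto simp: K_def)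
    then show ?thesis by simp
  qed
  define V where "V n k = W (g n (fst k)) (g n (snd k))" for n and k :: "nat \<times> nat"
  have V_meas[measurable]: "random_variable borel (V n k)" for n k
    unfolding V_def by (intro W_meas g_nonneg)
  have V_K: "V n (K n \<omega>) \<omega> = W (dyadic_above n (S \<omega>)) (dyadic_above n (T \<omega>)) \<omega>" for n \<omega>
    by (simp add: V_def K_def g_def dyadic_above_def)
  have VK_meas[measurable]: "random_variable borel (\<lambda>\<omega>. V n (K n \<omega>) \<omega>)" for n
    by (rule measurable_compose_countable[OF V_meas]) measurable
  have VK_lim: "(\<lambda>n. V n (K n \<omega>) \<omega>) \<longlonglongrightarrow> W (S \<omega>) (T \<omega>) \<omega>" if "\<omega> \<in> space M" for \<omega>
    unfolding V_K using that ST_nonneg by (intro W_lim dyadic_above_tendsto) (auto intro: dyadic_above_gt)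
  show W_ST[measurable]: "random_variable borel (\<lambda>\<omega>. W (S \<omega>) (T \<omega>) \<omega>)"
    by (rule borel_measurable_LIMSEQ_real[OF VK_lim VK_meas])
  have w_meas[measurable]: "(\<lambda>\<omega>. w (f \<omega>) (h \<omega>)) \<in> borel_measurable M"
    if [measurable]: "random_variable borel f" "random_variable borel h" for f h
    using measurable_compose[OF borel_measurable_Pair[OF that] borel_measurable_continuous_onI[OF w_cont]]
    by simp
  define w' where "w' n k = ennreal (w (g n (fst k)) (g n (snd k)))" for n and k :: "nat \<times> nat"
  have w'_K: "w' n (K n \<omega>) = ennreal (w (dyadic_above n (S \<omega>)) (dyadic_above n (T \<omega>)))" for n \<omega>
    by (simp add: w'_def K_def g_def dyadic_above_def)
  have mean_eq: "(\<integral>\<^sup>+\<omega>. ennreal (V n (K n \<omega>) \<omega>) \<partial>M) = (\<integral>\<^sup>+\<omega>. w' n (K n \<omega>) \<partial>M)" for n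
  proof (rule nn_integral_countable_mixture)
    fix k
    \<comment> \<open>The event that the rounded pair has index \<open>k\<close>, written as a
      function of \<open>(S, T)\<close>; hence it is independent of \<open>V n k\<close>.\<close>
    define \<phi> where "\<phi> = (\<lambda>z :: real \<times> real. indicator {k} (nat \<lfloor>2 ^ n * fst z\<rfloor>, nat \<lfloor>2 ^ n * snd z\<rfloor>) :: ennreal)"
    have [measurable]: "\<phi> \<in> borel_measurable (borel \<Otimes>\<^sub>M borel)"
      unfolding \<phi>_def by measurable
    have "indep_rvs borel (\<lambda>\<omega>. \<phi> (S \<omega>, T \<omega>)) borel (\<lambda>\<omega>. ennreal (V n k \<omega>))"
      unfolding V_def by (rule indep_rvs_compose[OF indep]) (auto simp: g_nonneg)
    from indep_var_nn_integral_mult[OF indep_rvs_imp_indep_var[OF this]]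
    show "(\<integral>\<^sup>+\<omega>. indicator {k} (K n \<omega>) * ennreal (V n k \<omega>) \<partial>M)
        = (\<integral>\<^sup>+\<omega>. indicator {k} (K n \<omega>) \<partial>M) * w' n k"
      using W_mean[OF g_nonneg g_nonneg, of n "fst k" n "snd k"]
      by (simp add: \<phi>_def K_def V_def w'_def)
  qed measurable
  have le1: "dyadic_above n x \<le> x + 1" if "0 \<le> x" for n x
    using dyadic_above_le_0[OF that, of n] dyadic_above_le[OF that, of 0] by simp
  have pos: "0 \<le> dyadic_above n x" if "0 \<le> x" for n x
    using dyadic_above_gt[of x n] that by linarith
  have w'_le: "w' n (K n \<omega>) \<le> ennreal (w (S \<omega> + 1) (T \<omega> + 1))" if "\<omega> \<in> space M" for n \<omega>
    unfolding w'_K using ST_nonneg[OF that] by (intro ennreal_leI w_mono le1 pos)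
  \<comment> \<open>Monotonicity is almost sure for each pair of fixed times. The grids are
    countable, so one null set suffices and random indices may be inserted.\<close>
  have grid_mono: "AE \<omega> in M. \<forall>k l. V n k \<omega> \<le> V 0 l \<omega> \<or> \<not> (g n (fst k) \<le> g 0 (fst l) \<and> g n (snd k) \<le> g 0 (snd l))" for n
    unfolding AE_all_countable
  proof (intro allI)
    fix k l
    show "AE \<omega> in M. V n k \<omega> \<le> V 0 l \<omega> \<or> \<not> (g n (fst k) \<le> g 0 (fst l) \<and> g n (snd k) \<le> g 0 (snd l))"
      using W_mono[OF g_nonneg _ g_nonneg, of n "fst k" "g 0 (fst l)" n "snd k" "g 0 (snd l)"]
      by (cases "g n (fst k) \<le> g 0 (fst l) \<and> g n (snd k) \<le> g 0 (snd l)") (auto simp: V_def)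
  qed
  have VK_le: "AE \<omega> in M. V n (K n \<omega>) \<omega> \<le> V 0 (K 0 \<omega>) \<omega>" for n
    using grid_mono[of n] AE_space
  proof eventually_elim
    case (elim \<omega>)
    have "g n (fst (K n \<omega>)) \<le> g 0 (fst (K 0 \<omega>))" "g n (snd (K n \<omega>)) \<le> g 0 (snd (K 0 \<omega>))"
      using dyadic_above_le_0[of "S \<omega>" n] dyadic_above_le_0[of "T \<omega>" n] ST_nonneg elim
      by (auto simp: K_def g_def dyadic_above_def)
    then show ?case using elim by blast
  qed
  \<comment> \<open>The majorant has finite mean because rounding at level 0 adds at most 1 to each
    time.\<close>
  have "(\<integral>\<^sup>+\<omega>. ennreal (V 0 (K 0 \<omega>) \<omega>) \<partial>M) \<le> (\<integral>\<^sup>+\<omega>. ennreal (w (S \<omega> + 1) (T \<omega> + 1)) \<partial>M)"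
    unfolding mean_eq by (rule nn_integral_mono) (rule w'_le)
  then have fin_V: "(\<integral>\<^sup>+\<omega>. ennreal (V 0 (K 0 \<omega>) \<omega>) \<partial>M) < \<infinity>"
    using fin by (rule le_less_trans)
  have 1: "(\<lambda>n. \<integral>\<^sup>+\<omega>. ennreal (V n (K n \<omega>) \<omega>) \<partial>M) \<longlonglongrightarrow> (\<integral>\<^sup>+\<omega>. ennreal (W (S \<omega>) (T \<omega>) \<omega>) \<partial>M)"
  proof (rule nn_integral_dominated_convergence[OF _ _ _ _ fin_V])
    show "AE \<omega> in M. ennreal (V n (K n \<omega>) \<omega>) \<le> ennreal (V 0 (K 0 \<omega>) \<omega>)" for n
      using VK_le[of n] by eventually_elim (rule ennreal_leI)
    show "AE \<omega> in M. (\<lambda>n. ennreal (V n (K n \<omega>) \<omega>)) \<longlonglongrightarrow> ennreal (W (S \<omega>) (T \<omega>) \<omega>)"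
      by (rule AE_I2) (intro tendsto_ennrealI VK_lim)
  qed measurable
  have 2: "(\<lambda>n. \<integral>\<^sup>+\<omega>. w' n (K n \<omega>) \<partial>M) \<longlonglongrightarrow> (\<integral>\<^sup>+\<omega>. ennreal (w (S \<omega>) (T \<omega>)) \<partial>M)"
  proof (rule nn_integral_dominated_convergence[OF _ _ _ _ fin])
    show "AE \<omega> in M. (\<lambda>n. w' n (K n \<omega>)) \<longlonglongrightarrow> ennreal (w (S \<omega>) (T \<omega>))"
    proof (rule AE_I2)
      fix \<omega> assume \<omega>: "\<omega> \<in> space M"
      have "(\<lambda>n. (dyadic_above n (S \<omega>), dyadic_above n (T \<omega>))) \<longlonglongrightarrow> (S \<omega>, T \<omega>)"
        using ST_nonneg[OF \<omega>] by (intro tendsto_Pair dyadic_above_tendsto)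
      from continuous_on_tendsto_compose[OF w_cont this]
      show "(\<lambda>n. w' n (K n \<omega>)) \<longlonglongrightarrow> ennreal (w (S \<omega>) (T \<omega>))"
        unfolding w'_K by (intro tendsto_ennrealI) simp
    qed
    show "(\<lambda>\<omega>. w' n (K n \<omega>)) \<in> borel_measurable M" for n
      unfolding w'_K by measurable
  qed (use w'_le in \<open>auto intro!: AE_I2\<close>)
  show "(\<integral>\<^sup>+\<omega>. ennreal (W (S \<omega>) (T \<omega>) \<omega>) \<partial>M) = (\<integral>\<^sup>+\<omega>. ennreal (w (S \<omega>) (T \<omega>)) \<partial>M)"
    using LIMSEQ_unique[OF 1[unfolded mean_eq] 2] .
qed

end

section \<open>Counting processes\<close>

lemma sum_of_nat_double: "2 * (\<Sum>i<n. real i) + real n = (real n)\<^sup>2"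
  by (induction n) (auto simp: power2_eq_square algebra_simps)

lemma of_nat_diff_sum_power: "real n - (\<Sum>i<n. u ^ i) = (1 - u) * (\<Sum>i<n. \<Sum>l<i. u ^ l)"
proof -
  have "real n - (\<Sum>i<n. u ^ i) = (\<Sum>i<n. 1 - u ^ i)"
    by (simp add: sum_subtractf)
  then show ?thesis
    by (simp add: one_diff_power_eq sum_distrib_left)
qed

context prob_space
begin

text \<open>The first two factorial moments are the increasing limits, as \<open>u\<close> tends to 1 from below, of
  the expectations of \<open>\<Sum>i<N. u ^ i\<close> and \<open>\<Sum>i<N. \<Sum>l<i. u ^ l\<close>, which are difference quotients of
  the generating function.\<close>

lemma
  fixes N :: "'a \<Rightarrow> nat" and r :: "nat \<Rightarrow> real"
  assumes [measurable]: "random_variable (count_space UNIV) N"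
    and k: "1 \<le> k" and r: "\<And>j. j \<in> {1..k} \<Longrightarrow> 0 < r j" and t: "0 < t"
    and pgf: "\<And>u. \<bar>u\<bar> \<le> 1 \<Longrightarrow> expectation (\<lambda>\<omega>. u ^ N \<omega>) = exp (- t * (\<Sum>j=1..k. r j * (1 - u ^ j)))"
  shows nn_integral_compound_poisson:
      "(\<integral>\<^sup>+\<omega>. ennreal (real (N \<omega>)) \<partial>M) = ennreal (t * (\<Sum>j=1..k. real j * r j))"
    and nn_integral_compound_poisson_square:
      "(\<integral>\<^sup>+\<omega>. ennreal ((real (N \<omega>))\<^sup>2) \<partial>M)
        = ennreal (t * (\<Sum>j=1..k. (real j)\<^sup>2 * r j) + t\<^sup>2 * (\<Sum>j=1..k. real j * r j)\<^sup>2)"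
proof -
  define m where "m = (\<Sum>j=1..k. real j * r j)"
  \<comment> \<open>For u \<noteq> 1, \<open>p1 u n\<close> is (1 - u^n)/(1 - u) and
    \<open>p2 u n\<close> is (n - p1 u n)/(1 - u); at u = 1 they are n and n(n-1)/2.
    \<open>Q\<close> and \<open>R\<close> are their sums weighted by the rates.\<close>
  define p1 where "p1 u n = (\<Sum>i<n. u ^ i)" for u :: real and n :: nat
  define p2 where "p2 u n = (\<Sum>i<n. p1 u i)" for u :: real and n :: nat
  define Q where "Q u = (\<Sum>j=1..k. r j * p1 u j)" for u
  define R where "R u = (\<Sum>j=1..k. r j * p2 u j)" for u
  \<comment> \<open>The shift by 2 keeps \<open>u n\<close> strictly inside (0,1) already for n =
    0.\<close>
  define h where "h n = 1 / (real n + 2)" for n :: nat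
  define u where "u n = 1 - h n" for n
  have h: "0 < h n" "h n < 1" for n by (simp_all add: h_def)
  have h_lim: "h \<longlonglongrightarrow> 0" unfolding h_def by real_asymp
  have u: "0 < u n" "u n < 1" "1 - u n = h n" for n using h[of n] by (simp_all add: u_def)
  have u_lim: "u \<longlonglongrightarrow> 1"
    using tendsto_diff[OF tendsto_const h_lim, of 1] by (simp add: u_def[abs_def])
  have u_mono: "u i \<le> u j" if "i \<le> j" for i j
    using that by (simp add: u_def h_def frac_le)
  have p1_lim: "(\<lambda>n. p1 (u n) i) \<longlonglongrightarrow> p1 1 i" for i
    unfolding p1_def by (intro tendsto_intros u_lim)
  have p2_lim: "(\<lambda>n. p2 (u n) i) \<longlonglongrightarrow> p2 1 i" for i
    unfolding p2_def by (intro tendsto_intros p1_lim)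
  have p1_mono: "p1 (u i) n \<le> p1 (u j) n" if "i \<le> j" for i j n
    unfolding p1_def using u(1)[of i] u_mono[OF that] by (intro sum_mono power_mono) auto
  have p2_mono: "p2 (u i) n \<le> p2 (u j) n" if "i \<le> j" for i j n
    unfolding p2_def using that by (intro sum_mono p1_mono)
  have p1_nonneg: "0 \<le> p1 (u i) n" for i n
    unfolding p1_def using u(1)[of i] by (intro sum_nonneg) auto
  have p2_nonneg: "0 \<le> p2 (u i) n" for i n
    unfolding p2_def by (intro sum_nonneg p1_nonneg)
  have Q_lim: "(\<lambda>n. Q (u n)) \<longlonglongrightarrow> m"
  proof -
    have "(\<lambda>n. Q (u n)) \<longlonglongrightarrow> (\<Sum>j=1..k. r j * p1 1 j)"
      unfolding Q_def by (intro tendsto_intros p1_lim)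
    then show ?thesis by (simp add: m_def p1_def mult.commute)
  qed
  have R_lim: "(\<lambda>n. R (u n)) \<longlonglongrightarrow> R 1"
    unfolding R_def by (intro tendsto_intros p2_lim)
  have Q_pos: "0 < Q (u n)" for n
  proof -
    have "0 < p1 (u n) j" if "1 \<le> j" for j
      unfolding p1_def using that u(1)[of n] by (intro sum_pos) (auto simp: lessThan_empty_iff)
    then show ?thesis
      unfolding Q_def using k r by (intro sum_pos) auto
  qed
  have diff_p1: "real i - p1 (u n) i = h n * p2 (u n) i" for n i
    unfolding p2_def p1_def using of_nat_diff_sum_power[of i "u n"] u(3)[of n] by simp
  have m_Q: "m - Q (u n) = h n * R (u n)" for n
  proof -
    have "m - Q (u n) = (\<Sum>j=1..k. r j * (real j - p1 (u n) j))"
      by (simp add: m_def Q_def right_diff_distrib sum_subtractf mult.commute)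
    then show ?thesis
      by (simp add: diff_p1 R_def sum_distrib_left mult.left_commute)
  qed
  \<comment> \<open>\<open>x n\<close> is the negated exponent of the generating function at
    \<open>u n\<close>. It tends to 0 from the right, so expansions of exp at 0 apply.\<close>
  define x where "x n = t * h n * Q (u n)" for n
  have x_pos: "0 < x n" for n using t h[of n] Q_pos[of n] by (simp add: x_def)
  have x_lim: "x \<longlonglongrightarrow> 0"
    using tendsto_mult[OF tendsto_mult[OF tendsto_const h_lim] Q_lim, of t] by (simp add: x_def[abs_def])
  have x_right: "filterlim x (at_right 0) sequentially"
    using x_lim x_pos by (intro tendsto_imp_filterlim_at_right) auto
  have pow: "1 - u n ^ i = h n * p1 (u n) i" for n i
    unfolding p1_def using u(3)[of n] by (simp add: one_diff_power_eq)
  have G: "expectation (\<lambda>\<omega>. u n ^ N \<omega>) = exp (- x n)" for n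
  proof -
    have "(\<Sum>j=1..k. r j * (1 - u n ^ j)) = h n * Q (u n)"
      unfolding pow by (simp add: Q_def sum_distrib_left mult.left_commute)
    then show ?thesis using pgf[of "u n"] u[of n] by (simp add: x_def)
  qed
  have int_u: "integrable M (\<lambda>\<omega>. u n ^ N \<omega>)" for n
    using u(1,2)[of n] by (intro integrable_const_bound[where B=1]) (auto simp: power_le_one)
  have p1_eq: "p1 (u n) i = (1 - u n ^ i) / h n" for n i
    using pow[of n i] h[of n] by simp
  have int_p1: "integrable M (\<lambda>\<omega>. p1 (u n) (N \<omega>))" for n
    unfolding p1_eq using int_u[of n] by simp
  have E_p1: "expectation (\<lambda>\<omega>. p1 (u n) (N \<omega>)) = (1 - exp (- x n)) / h n" for n
    unfolding p1_eq using int_u[of n] by (simp add: G prob_space)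
  have "((\<lambda>x :: real. (1 - exp (- x)) / x) \<longlongrightarrow> 1) (at_right 0)" by real_asymp
  from filterlim_compose[OF this x_right]
  have "(\<lambda>n. t * Q (u n) * ((1 - exp (- x n)) / x n)) \<longlonglongrightarrow> t * m * 1"
    by (intro tendsto_mult tendsto_const Q_lim)
  moreover have "t * Q (u n) * ((1 - exp (- x n)) / x n) = expectation (\<lambda>\<omega>. p1 (u n) (N \<omega>))" for n
    unfolding E_p1 using t h[of n] Q_pos[of n] by (simp add: x_def)
  ultimately have lim1: "(\<lambda>n. expectation (\<lambda>\<omega>. p1 (u n) (N \<omega>))) \<longlonglongrightarrow> t * m" by simp
  have "(\<lambda>n. \<integral>\<^sup>+\<omega>. ennreal (p1 (u n) (N \<omega>)) \<partial>M) \<longlonglongrightarrow> (\<integral>\<^sup>+\<omega>. ennreal (p1 1 (N \<omega>)) \<partial>M)"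
    by (rule nn_integral_LIMSEQ) (auto simp: incseq_def le_fun_def intro!: ennreal_leI p1_mono tendsto_ennrealI p1_lim)
  moreover have "(\<integral>\<^sup>+\<omega>. ennreal (p1 (u n) (N \<omega>)) \<partial>M) = ennreal (expectation (\<lambda>\<omega>. p1 (u n) (N \<omega>)))" for n
    by (rule nn_integral_eq_integral[OF int_p1]) (simp add: p1_nonneg)
  ultimately have 1: "(\<integral>\<^sup>+\<omega>. ennreal (p1 1 (N \<omega>)) \<partial>M) = ennreal (t * m)"
    using LIMSEQ_unique tendsto_ennrealI[OF lim1] by simp
  then show mean: "(\<integral>\<^sup>+\<omega>. ennreal (real (N \<omega>)) \<partial>M) = ennreal (t * (\<Sum>j=1..k. real j * r j))"
    by (simp add: p1_def m_def)
  have m_nonneg: "0 \<le> m"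
    unfolding m_def using r by (intro sum_nonneg) (auto intro: less_imp_le)
  have int_N: "integrable M (\<lambda>\<omega>. real (N \<omega>))"
    by (rule integrableI_nonneg) (auto simp: mean)
  have E_N: "expectation (\<lambda>\<omega>. real (N \<omega>)) = t * m"
  proof -
    have "ennreal (expectation (\<lambda>\<omega>. real (N \<omega>))) = ennreal (t * m)"
      using nn_integral_eq_integral[OF int_N] mean by (simp add: m_def)
    then show ?thesis
      using m_nonneg t by (subst (asm) ennreal_inj) (auto intro: integral_nonneg_AE)
  qed
  have p2_eq: "p2 (u n) i = (real i - p1 (u n) i) / h n" for n i
    using diff_p1[of i n] h[of n] by simp
  have int_p2: "integrable M (\<lambda>\<omega>. p2 (u n) (N \<omega>))" for n
    unfolding p2_eq using int_p1[of n] int_N by simp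
  have E_p2: "expectation (\<lambda>\<omega>. p2 (u n) (N \<omega>)) = (t * m - (1 - exp (- x n)) / h n) / h n" for n
    unfolding p2_eq using int_p1[of n] int_N by (simp add: E_p1 E_N)
  \<comment> \<open>With x = t h Q the quotient (t m - (1 - exp(-x))/h)/h splits into (t m h -
    x)/h^2 = t R and (x - 1 + exp(-x))/h^2 = (t Q)^2 (x - 1 + exp(-x))/x^2, each with a
    limit.\<close>
  have "((\<lambda>x :: real. (x - 1 + exp (- x)) / x\<^sup>2) \<longlongrightarrow> 1 / 2) (at_right 0)" by real_asymp
  from filterlim_compose[OF this x_right]
  have chi: "(\<lambda>n. (x n - 1 + exp (- x n)) / (x n)\<^sup>2) \<longlonglongrightarrow> 1 / 2" .
  have "(\<lambda>n. t * R (u n) + (t * Q (u n))\<^sup>2 * ((x n - 1 + exp (- x n)) / (x n)\<^sup>2)) \<longlonglongrightarrow> t * R 1 + (t * m)\<^sup>2 * (1 / 2)"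
    by (intro tendsto_add tendsto_mult tendsto_power tendsto_const Q_lim R_lim chi)
  moreover have "t * R (u n) + (t * Q (u n))\<^sup>2 * ((x n - 1 + exp (- x n)) / (x n)\<^sup>2)
      = expectation (\<lambda>\<omega>. p2 (u n) (N \<omega>))" for n
  proof -
    have "(t * Q (u n))\<^sup>2 * ((x n - 1 + exp (- x n)) / (x n)\<^sup>2) = (x n - 1 + exp (- x n)) / (h n)\<^sup>2"
      using t h[of n] Q_pos[of n] by (simp add: x_def power_mult_distrib)
    moreover have "t * R (u n) = (t * m * h n - x n) / (h n)\<^sup>2"
    proof -
      have "t * m * h n - x n = t * h n * (m - Q (u n))" by (simp add: x_def algebra_simps)
      then show ?thesis unfolding m_Q using h[of n] by (simp add: power2_eq_square)
    qed
    ultimately show ?thesis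
      unfolding E_p2 using h[of n] by (simp add: field_simps power2_eq_square)
  qed
  ultimately have lim2: "(\<lambda>n. expectation (\<lambda>\<omega>. p2 (u n) (N \<omega>))) \<longlonglongrightarrow> t * R 1 + (t * m)\<^sup>2 * (1 / 2)" by simp
  have "(\<lambda>n. \<integral>\<^sup>+\<omega>. ennreal (p2 (u n) (N \<omega>)) \<partial>M) \<longlonglongrightarrow> (\<integral>\<^sup>+\<omega>. ennreal (p2 1 (N \<omega>)) \<partial>M)"
    by (rule nn_integral_LIMSEQ) (auto simp: incseq_def le_fun_def intro!: ennreal_leI p2_mono tendsto_ennrealI p2_lim)
  moreover have "(\<integral>\<^sup>+\<omega>. ennreal (p2 (u n) (N \<omega>)) \<partial>M) = ennreal (expectation (\<lambda>\<omega>. p2 (u n) (N \<omega>)))" for n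
    by (rule nn_integral_eq_integral[OF int_p2]) (simp add: p2_nonneg)
  ultimately have 2: "(\<integral>\<^sup>+\<omega>. ennreal (p2 1 (N \<omega>)) \<partial>M) = ennreal (t * R 1 + (t * m)\<^sup>2 * (1 / 2))"
    using LIMSEQ_unique tendsto_ennrealI[OF lim2] by simp
  \<comment> \<open>n^2 = n(n-1) + n leads back from factorial moments; the same identity is later
    applied to the jump sizes j.\<close>
  have sq: "(real i)\<^sup>2 = 2 * p2 1 i + real i" for i
    using sum_of_nat_double[of i] by (simp add: p2_def p1_def)
  have R1: "0 \<le> R 1"
    unfolding R_def p2_def p1_def using r by (intro sum_nonneg mult_nonneg_nonneg) (auto intro: less_imp_le)
  have "(\<integral>\<^sup>+\<omega>. ennreal ((real (N \<omega>))\<^sup>2) \<partial>M) = (\<integral>\<^sup>+\<omega>. 2 * ennreal (p2 1 (N \<omega>)) + ennreal (real (N \<omega>)) \<partial>M)"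
    unfolding sq by (intro nn_integral_cong) (simp add: p2_def p1_def sum_nonneg ennreal_plus ennreal_mult)
  also have "\<dots> = 2 * (\<integral>\<^sup>+\<omega>. ennreal (p2 1 (N \<omega>)) \<partial>M) + (\<integral>\<^sup>+\<omega>. ennreal (real (N \<omega>)) \<partial>M)"
    by (simp add: nn_integral_add nn_integral_cmult)
  also have "\<dots> = ennreal (2 * (t * R 1 + (t * m)\<^sup>2 * (1 / 2)) + t * m)"
  proof -
    have "2 * ennreal a + ennreal b = ennreal (2 * a + b)" if "0 \<le> a" "0 \<le> b" for a b
      using that by (simp add: ennreal_plus ennreal_mult)
    then show ?thesis
      unfolding 2 mean m_def[symmetric] using t m_nonneg R1 by simp
  qed
  also have "2 * (t * R 1 + (t * m)\<^sup>2 * (1 / 2)) + t * m = t * (\<Sum>j=1..k. (real j)\<^sup>2 * r j) + t\<^sup>2 * m\<^sup>2"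
  proof -
    have "(\<Sum>j=1..k. (real j)\<^sup>2 * r j) = 2 * R 1 + m"
      unfolding sq R_def m_def by (simp add: sum.distrib sum_distrib_left algebra_simps)
    then show ?thesis by (simp add: power_mult_distrib algebra_simps)
  qed
  finally show "(\<integral>\<^sup>+\<omega>. ennreal ((real (N \<omega>))\<^sup>2) \<partial>M)
        = ennreal (t * (\<Sum>j=1..k. (real j)\<^sup>2 * r j) + t\<^sup>2 * (\<Sum>j=1..k. real j * r j)\<^sup>2)"
    by (simp add: m_def)
qed

section \<open>Second-order structure and its stability under time change\<close>

text \<open>The properties of a counting process that matter here; they are inherited by the composition of
  independent processes of this kind.\<close>

definition linear_moments :: "real \<Rightarrow> real \<Rightarrow> (real \<Rightarrow> 'a \<Rightarrow> nat) \<Rightarrow> bool" where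
  "linear_moments v m Z \<longleftrightarrow>
     (\<forall>x\<ge>0. random_variable (count_space UNIV) (Z x)) \<and>
     (\<forall>\<omega>\<in>space M. \<forall>x\<ge>0. \<forall>\<^sub>F y in at_right x. Z y \<omega> = Z x \<omega>) \<and>
     (\<forall>x\<ge>0. \<forall>y\<ge>x. AE \<omega> in M. Z x \<omega> \<le> Z y \<omega>) \<and>
     (\<forall>x\<ge>0. (\<integral>\<^sup>+\<omega>. ennreal (real (Z x \<omega>)) \<partial>M) = ennreal (m * x)) \<and>
     (\<forall>x\<ge>0. \<forall>y\<ge>0. (\<integral>\<^sup>+\<omega>. ennreal (real (Z x \<omega>) * real (Z y \<omega>)) \<partial>M) = ennreal (v * min x y + m\<^sup>2 * x * y))"

lemma linear_momentsD:
  assumes "linear_moments v m Z" "0 \<le> x"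
  shows "random_variable (count_space UNIV) (Z x)"
    and "\<omega> \<in> space M \<Longrightarrow> \<forall>\<^sub>F y in at_right x. Z y \<omega> = Z x \<omega>"
    and "x \<le> y \<Longrightarrow> AE \<omega> in M. Z x \<omega> \<le> Z y \<omega>"
    and "(\<integral>\<^sup>+\<omega>. ennreal (real (Z x \<omega>)) \<partial>M) = ennreal (m * x)"
    and "0 \<le> y \<Longrightarrow> (\<integral>\<^sup>+\<omega>. ennreal (real (Z x \<omega>) * real (Z y \<omega>)) \<partial>M) = ennreal (v * min x y + m\<^sup>2 * x * y)"
  using assms unfolding linear_moments_def by blast+

lemma linear_moments_square_integrable:
  assumes "linear_moments v m Z" "0 \<le> x"
  shows "integrable M (\<lambda>\<omega>. (real (Z x \<omega>))\<^sup>2)"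
proof (rule integrableI_nonneg)
  note linear_momentsD(1)[OF assms, measurable]
  show "(\<lambda>\<omega>. (real (Z x \<omega>))\<^sup>2) \<in> borel_measurable M" by measurable
  show "(\<integral>\<^sup>+\<omega>. ennreal ((real (Z x \<omega>))\<^sup>2) \<partial>M) < \<infinity>"
    using linear_momentsD(5)[OF assms assms(2)] by (simp add: power2_eq_square)
qed simp

lemma eventually_at_right_sequence:
  assumes "\<forall>\<^sub>F y in at_right x. P y" "p \<longlonglongrightarrow> x" "\<forall>n::nat. x < p n"
  shows "\<forall>\<^sub>F n in sequentially. P (p n)"
  using assms by (intro eventually_compose_filterlim[OF assms(1)] tendsto_imp_filterlim_at_right) auto

text \<open>The random-time result is applied to \<open>Z x\<close> and to products of
  \<open>Z x\<close> and \<open>Z y\<close>. Its limit hypothesis is immediate, as these paths are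
  constant just to the right of each time; square integrability of the times bounds the
  majorant.\<close>

lemma
  fixes S T :: "'a \<Rightarrow> real"
  assumes Z: "linear_moments v m Z" and vm: "0 \<le> v" "0 \<le> m"
    and ST_meas[measurable]: "random_variable borel S" "random_variable borel T"
    and ST_nonneg: "\<And>\<omega>. \<omega> \<in> space M \<Longrightarrow> 0 \<le> S \<omega>" "\<And>\<omega>. \<omega> \<in> space M \<Longrightarrow> 0 \<le> T \<omega>"
    and ST_sq: "integrable M (\<lambda>\<omega>. (S \<omega>)\<^sup>2)" "integrable M (\<lambda>\<omega>. (T \<omega>)\<^sup>2)"
    and indep: "\<And>x y. 0 \<le> x \<Longrightarrow> 0 \<le> y \<Longrightarrow> indep_rvs (borel \<Otimes>\<^sub>M borel) (\<lambda>\<omega>. (S \<omega>, T \<omega>))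
        (count_space UNIV \<Otimes>\<^sub>M count_space UNIV) (\<lambda>\<omega>. (Z x \<omega>, Z y \<omega>))"
  shows linear_moments_time_measurable: "random_variable (count_space UNIV) (\<lambda>\<omega>. Z (S \<omega>) \<omega>)"
    and linear_moments_time_mean:
      "(\<integral>\<^sup>+\<omega>. ennreal (real (Z (S \<omega>) \<omega>)) \<partial>M) = (\<integral>\<^sup>+\<omega>. ennreal (m * S \<omega>) \<partial>M)"
    and linear_moments_time_product:
      "(\<integral>\<^sup>+\<omega>. ennreal (real (Z (S \<omega>) \<omega>) * real (Z (T \<omega>) \<omega>)) \<partial>M)
        = (\<integral>\<^sup>+\<omega>. ennreal (v * min (S \<omega>) (T \<omega>) + m\<^sup>2 * S \<omega> * T \<omega>) \<partial>M)"
proof -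
  note ZD = linear_momentsD[OF Z]
  have ST_int: "integrable M S" "integrable M T" "integrable M (\<lambda>\<omega>. S \<omega> * T \<omega>)"
    using square_integrable_imp_integrable[OF ST_meas(1) ST_sq(1)]
      square_integrable_imp_integrable[OF ST_meas(2) ST_sq(2)]
      integrable_mult_of_square_integrable[OF ST_meas ST_sq] .
  have seq: "\<forall>\<^sub>F n in sequentially. Z (p n) \<omega> = Z x \<omega>"
    if "\<omega> \<in> space M" "0 \<le> x" "p \<longlonglongrightarrow> x" "\<forall>n. x < p n" for \<omega> x and p :: "nat \<Rightarrow> real"
    using eventually_at_right_sequence[OF ZD(2)[OF that(2,1)] that(3,4)] .
  have Z_meas: "random_variable borel (\<lambda>\<omega>. real (Z x \<omega>))" if "0 \<le> x" for x
    using ZD(1)[OF that] by measurable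
  have ind1: "indep_rvs (borel \<Otimes>\<^sub>M borel) (\<lambda>\<omega>. (S \<omega>, T \<omega>)) borel (\<lambda>\<omega>. real (Z x \<omega>))" if "0 \<le> x" for x
    using indep_rvs_compose[OF indep[OF that that], of "\<lambda>p. p" "borel \<Otimes>\<^sub>M borel" "\<lambda>p. real (fst p)" borel] by simp
  have ind2: "indep_rvs (borel \<Otimes>\<^sub>M borel) (\<lambda>\<omega>. (S \<omega>, T \<omega>)) borel (\<lambda>\<omega>. real (Z x \<omega>) * real (Z y \<omega>))"
    if "0 \<le> x" "0 \<le> y" for x y
    using indep_rvs_compose[OF indep[OF that], of "\<lambda>p. p" "borel \<Otimes>\<^sub>M borel" "\<lambda>p. real (fst p) * real (snd p)" borel] by simp
  have lim1: "(\<lambda>n. real (Z (p n) \<omega>)) \<longlonglongrightarrow> real (Z x \<omega>)"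
    if "\<omega> \<in> space M" "0 \<le> x" "p \<longlonglongrightarrow> x" "\<forall>n. x < p n" for \<omega> x and p :: "nat \<Rightarrow> real"
    using seq[OF that] by (intro tendsto_eventually) (auto elim: eventually_mono)
  have mono1: "AE \<omega> in M. real (Z x \<omega>) \<le> real (Z y \<omega>)" if "0 \<le> x" "x \<le> y" for x y
    using ZD(3)[OF that] by eventually_elim simp
  have mono2: "AE \<omega> in M. real (Z x \<omega>) * real (Z y \<omega>) \<le> real (Z x' \<omega>) * real (Z y' \<omega>)"
    if "0 \<le> x" "x \<le> x'" "0 \<le> y" "y \<le> y'" for x y x' y'
    using mono1[OF that(1,2)] mono1[OF that(3,4)] by eventually_elim (intro mult_mono, auto)
  have fin1: "(\<integral>\<^sup>+\<omega>. ennreal (m * (S \<omega> + 1)) \<partial>M) < \<infinity>"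
  proof -
    have "integrable M (\<lambda>\<omega>. m * (S \<omega> + 1))" using ST_int by simp
    then show ?thesis
      using vm ST_nonneg by (subst nn_integral_eq_integral) (auto intro!: AE_I2)
  qed
  have fin2: "(\<integral>\<^sup>+\<omega>. ennreal (v * min (S \<omega> + 1) (T \<omega> + 1) + m\<^sup>2 * (S \<omega> + 1) * (T \<omega> + 1)) \<partial>M) < \<infinity>"
  proof -
    have "integrable M (\<lambda>\<omega>. v * (S \<omega> + 1) + m\<^sup>2 * (S \<omega> + 1) * (T \<omega> + 1))"
    proof -
      have "(\<lambda>\<omega>. v * (S \<omega> + 1) + m\<^sup>2 * (S \<omega> + 1) * (T \<omega> + 1))
          = (\<lambda>\<omega>. v * S \<omega> + m\<^sup>2 * (S \<omega> * T \<omega>) + m\<^sup>2 * S \<omega> + m\<^sup>2 * T \<omega> + (v + m\<^sup>2))"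
        by (auto simp: algebra_simps)
      then show ?thesis using ST_int by simp
    qed
    then have "(\<integral>\<^sup>+\<omega>. ennreal (v * (S \<omega> + 1) + m\<^sup>2 * (S \<omega> + 1) * (T \<omega> + 1)) \<partial>M) < \<infinity>"
      using vm ST_nonneg by (subst nn_integral_eq_integral) (auto intro!: AE_I2)
    moreover have "(\<integral>\<^sup>+\<omega>. ennreal (v * min (S \<omega> + 1) (T \<omega> + 1) + m\<^sup>2 * (S \<omega> + 1) * (T \<omega> + 1)) \<partial>M)
        \<le> (\<integral>\<^sup>+\<omega>. ennreal (v * (S \<omega> + 1) + m\<^sup>2 * (S \<omega> + 1) * (T \<omega> + 1)) \<partial>M)"
      using vm by (intro nn_integral_mono ennreal_leI add_right_mono mult_left_mono) auto
    ultimately show ?thesis by (rule le_less_trans[rotated])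
  qed
  have "random_variable borel (\<lambda>\<omega>. real (Z (S \<omega>) \<omega>))"
    by (rule random_time_measurable[where W="\<lambda>x y \<omega>. real (Z x \<omega>)" and w="\<lambda>x y. m * x" and S=S and T=T])
      (use vm ST_nonneg fin1 in \<open>auto intro!: Z_meas lim1 ZD(3,4) ind1 continuous_intros mult_left_mono\<close>)
  \<comment> \<open>\<open>nat\<close> of the floor undoes \<open>real\<close> and leads from Borel
    to discrete measurability.\<close>
  then have "random_variable (count_space UNIV) (\<lambda>\<omega>. nat \<lfloor>real (Z (S \<omega>) \<omega>)\<rfloor>)"
    by measurable
  then show "random_variable (count_space UNIV) (\<lambda>\<omega>. Z (S \<omega>) \<omega>)" by simp
  show "(\<integral>\<^sup>+\<omega>. ennreal (real (Z (S \<omega>) \<omega>)) \<partial>M) = (\<integral>\<^sup>+\<omega>. ennreal (m * S \<omega>) \<partial>M)"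
    by (rule nn_integral_random_time[where W="\<lambda>x y \<omega>. real (Z x \<omega>)" and w="\<lambda>x y. m * x" and S=S and T=T])
      (use vm ST_nonneg fin1 in \<open>auto intro!: Z_meas lim1 ZD(3,4) ind1 continuous_intros mult_left_mono\<close>)
  show "(\<integral>\<^sup>+\<omega>. ennreal (real (Z (S \<omega>) \<omega>) * real (Z (T \<omega>) \<omega>)) \<partial>M)
      = (\<integral>\<^sup>+\<omega>. ennreal (v * min (S \<omega>) (T \<omega>) + m\<^sup>2 * S \<omega> * T \<omega>) \<partial>M)"
  proof (rule nn_integral_random_time[where W="\<lambda>x y \<omega>. real (Z x \<omega>) * real (Z y \<omega>)"
        and w="\<lambda>x y. v * min x y + m\<^sup>2 * x * y" and S=S and T=T])
    show "continuous_on UNIV (\<lambda>z. v * min (fst z) (snd z) + m\<^sup>2 * fst z * snd z)"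
      by (intro continuous_intros)
    show "v * min x y + m\<^sup>2 * x * y \<le> v * min x' y' + m\<^sup>2 * x' * y'"
      if "0 \<le> x" "x \<le> x'" "0 \<le> y" "y \<le> y'" for x y x' y'
      using that vm by (intro add_mono mult_mono) auto
    show "random_variable borel (\<lambda>\<omega>. real (Z x \<omega>) * real (Z y \<omega>))" if "0 \<le> x" "0 \<le> y" for x y
      using Z_meas[OF that(1)] Z_meas[OF that(2)] by measurable
  qed (use ST_nonneg fin2 in \<open>auto intro!: tendsto_mult lim1 mono2 ZD(5) ind2\<close>)
qed

text \<open>The generating function is that of a compound Poisson law with jumps of size j at rate
  \<open>r j\<close>, which explains the two sums as variance rate and mean rate. For x < y the
  mixed moment comes from writing \<open>N y\<close> as \<open>N x\<close> plus an independent
  increment.\<close>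

lemma generalized_counting_process_linear_moments:
  assumes gcp: "generalized_counting_process k r N" and k: "1 \<le> k" and r: "\<forall>j\<in>{1..k}. 0 < r j"
  shows "linear_moments (\<Sum>j=1..k. (real j)\<^sup>2 * r j) (\<Sum>j=1..k. real j * r j) N"
proof -
  define m where "m = (\<Sum>j=1..k. real j * r j)"
  define v where "v = (\<Sum>j=1..k. (real j)\<^sup>2 * r j)"
  have vm: "0 \<le> v" "0 \<le> m"
  proof -
    have "0 \<le> r j" if "j \<in> {1..k}" for j using r that by (intro less_imp_le) blast
    then show "0 \<le> v" "0 \<le> m"
      unfolding v_def m_def by (auto intro!: sum_nonneg mult_nonneg_nonneg)
  qed
  have meas[measurable]: "random_variable (count_space UNIV) (N t)" if "0 \<le> t" for t
    using gcp that unfolding generalized_counting_process_def by blast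
  have zero: "N 0 \<omega> = 0" if "\<omega> \<in> space M" for \<omega>
    using gcp that unfolding generalized_counting_process_def by blast
  have cont: "continuous (at_right t) (\<lambda>s. N s \<omega>)" if "\<omega> \<in> space M" "0 \<le> t" for \<omega> t
    using gcp that unfolding generalized_counting_process_def by blast
  have ind: "independent_increments (\<lambda>t \<omega>. real (N t \<omega>))"
    and stat: "stationary_increments (\<lambda>t \<omega>. real (N t \<omega>))"
    using gcp unfolding generalized_counting_process_def by blast+
  have pgf: "expectation (\<lambda>\<omega>. u ^ N t \<omega>) = exp (- t * (\<Sum>j=1..k. r j * (1 - u ^ j)))"
    if "0 \<le> t" "\<bar>u\<bar> \<le> 1" for t u
    using gcp that unfolding generalized_counting_process_def by blast
  have mean: "(\<integral>\<^sup>+\<omega>. ennreal (real (N t \<omega>)) \<partial>M) = ennreal (m * t)"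
    and square: "(\<integral>\<^sup>+\<omega>. ennreal ((real (N t \<omega>))\<^sup>2) \<partial>M) = ennreal (v * t + m\<^sup>2 * t\<^sup>2)" if t: "0 \<le> t" for t
  proof -
    have "(\<integral>\<^sup>+\<omega>. ennreal (real (N t \<omega>)) \<partial>M) = ennreal (m * t)
        \<and> (\<integral>\<^sup>+\<omega>. ennreal ((real (N t \<omega>))\<^sup>2) \<partial>M) = ennreal (v * t + m\<^sup>2 * t\<^sup>2)"
    proof (cases "t = 0")
      case True
      have "(\<integral>\<^sup>+\<omega>. ennreal (real (N 0 \<omega>)) \<partial>M) = (\<integral>\<^sup>+\<omega>. 0 \<partial>M)"
        "(\<integral>\<^sup>+\<omega>. ennreal ((real (N 0 \<omega>))\<^sup>2) \<partial>M) = (\<integral>\<^sup>+\<omega>. 0 \<partial>M)"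
        by (rule nn_integral_cong; simp add: zero)+
      then show ?thesis using True by simp
    next
      case False
      then have "0 < t" using t by simp
      then show ?thesis
        using nn_integral_compound_poisson[OF meas[OF t] k _ _ pgf[OF t]]
          nn_integral_compound_poisson_square[OF meas[OF t] k _ _ pgf[OF t]] r
        by (simp add: m_def v_def mult.commute)
    qed
    then show "(\<integral>\<^sup>+\<omega>. ennreal (real (N t \<omega>)) \<partial>M) = ennreal (m * t)"
      "(\<integral>\<^sup>+\<omega>. ennreal ((real (N t \<omega>))\<^sup>2) \<partial>M) = ennreal (v * t + m\<^sup>2 * t\<^sup>2)" by auto
  qed
  \<comment> \<open>Monotonicity is derived from the law: the increment is distributed like
    \<open>N (y - x) - N 0\<close>, which is nonnegative as \<open>N 0\<close> vanishes.\<close>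
  have mono: "AE \<omega> in M. N x \<omega> \<le> N y \<omega>" if x: "0 \<le> x" and xy: "x \<le> y" for x y
  proof -
    have y: "0 \<le> y" and yx: "0 \<le> y - x" using x xy by auto
    note [measurable] = meas[OF x] meas[OF y] meas[OF yx] meas[OF order_refl]
    have "distr M borel (\<lambda>\<omega>. real (N (x + (y - x)) \<omega>) - real (N x \<omega>))
        = distr M borel (\<lambda>\<omega>. real (N (y - x) \<omega>) - real (N 0 \<omega>))"
      using stat x yx unfolding stationary_increments_def by blast
    then have eq: "distr M borel (\<lambda>\<omega>. real (N y \<omega>) - real (N x \<omega>))
        = distr M borel (\<lambda>\<omega>. real (N (y - x) \<omega>) - real (N 0 \<omega>))" by simp
    have "AE z in distr M borel (\<lambda>\<omega>. real (N (y - x) \<omega>) - real (N 0 \<omega>)). 0 \<le> z"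
      by (subst AE_distr_iff) (auto simp: zero intro!: AE_I2)
    then have "AE z in distr M borel (\<lambda>\<omega>. real (N y \<omega>) - real (N x \<omega>)). 0 \<le> z"
      by (simp only: eq)
    then show ?thesis
      by (subst (asm) AE_distr_iff) auto
  qed
  have int1: "integrable M (\<lambda>\<omega>. real (N t \<omega>))" if "0 \<le> t" for t
    using meas[OF that] mean[OF that] by (intro integrableI_nonneg) auto
  have int2: "integrable M (\<lambda>\<omega>. (real (N t \<omega>))\<^sup>2)" if "0 \<le> t" for t
    using meas[OF that] square[OF that] by (intro integrableI_nonneg) auto
  have E1: "expectation (\<lambda>\<omega>. real (N t \<omega>)) = m * t" if "0 \<le> t" for t
  proof -
    have "ennreal (expectation (\<lambda>\<omega>. real (N t \<omega>))) = ennreal (m * t)"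
      using nn_integral_eq_integral[OF int1[OF that]] mean[OF that] by simp
    then show ?thesis
      using vm that by (subst (asm) ennreal_inj) (auto intro: integral_nonneg_AE)
  qed
  have E2: "expectation (\<lambda>\<omega>. (real (N t \<omega>))\<^sup>2) = v * t + m\<^sup>2 * t\<^sup>2" if "0 \<le> t" for t
  proof -
    have "ennreal (expectation (\<lambda>\<omega>. (real (N t \<omega>))\<^sup>2)) = ennreal (v * t + m\<^sup>2 * t\<^sup>2)"
      using nn_integral_eq_integral[OF int2[OF that]] square[OF that] by simp
    then show ?thesis
      using vm that by (subst (asm) ennreal_inj) (auto intro: integral_nonneg_AE)
  qed
  have E12: "expectation (\<lambda>\<omega>. real (N x \<omega>) * real (N y \<omega>)) = v * x + m\<^sup>2 * x * y"
    if x: "0 \<le> x" and xy: "x \<le> y" for x y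
  proof -
    consider "x = 0" | "x = y" | "0 < x" "x < y" using x xy by linarith
    then show ?thesis
    proof cases
      case 1
      have "expectation (\<lambda>\<omega>. real (N x \<omega>) * real (N y \<omega>)) = expectation (\<lambda>\<omega>. 0)"
        by (rule Bochner_Integration.integral_cong) (simp_all add: 1 zero)
      then show ?thesis using 1 by simp
    next
      case 2
      then show ?thesis using E2[OF x] by (simp add: power2_eq_square mult.assoc)
    next
      case 3
      have y: "0 \<le> y" using 3 by simp
      have inc: "indep_var borel (\<lambda>\<omega>. real (N x \<omega>) - real (N 0 \<omega>)) borel (\<lambda>\<omega>. real (N y \<omega>) - real (N x \<omega>))"
        using independent_increments_indep_var[OF ind, of 0 x y] 3 by simp
      note [simp] = int1[OF x] int1[OF y] int1[OF order_refl] int2[OF x] int2[OF y]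
      have E0: "expectation (\<lambda>\<omega>. real (N 0 \<omega>)) = 0" using E1[of 0] by simp
      have int_xy: "integrable M (\<lambda>\<omega>. real (N x \<omega>) * real (N y \<omega>))"
        using meas[OF x] meas[OF y] by (intro integrable_mult_of_square_integrable) auto
      have "expectation (\<lambda>\<omega>. real (N x \<omega>) * real (N y \<omega>))
          = expectation (\<lambda>\<omega>. (real (N x \<omega>))\<^sup>2 + (real (N x \<omega>) - real (N 0 \<omega>)) * (real (N y \<omega>) - real (N x \<omega>)))"
        by (rule Bochner_Integration.integral_cong) (simp_all add: zero power2_eq_square algebra_simps)
      also have "\<dots> = expectation (\<lambda>\<omega>. (real (N x \<omega>))\<^sup>2)
          + expectation (\<lambda>\<omega>. (real (N x \<omega>) - real (N 0 \<omega>)) * (real (N y \<omega>) - real (N x \<omega>)))"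
        by (rule Bochner_Integration.integral_add) (simp_all add: indep_var_integrable[OF inc])
      also have "expectation (\<lambda>\<omega>. (real (N x \<omega>) - real (N 0 \<omega>)) * (real (N y \<omega>) - real (N x \<omega>)))
          = expectation (\<lambda>\<omega>. real (N x \<omega>) - real (N 0 \<omega>)) * expectation (\<lambda>\<omega>. real (N y \<omega>) - real (N x \<omega>))"
        by (rule indep_var_lebesgue_integral[OF inc]) simp_all
      also have "\<dots> = m * x * (m * y - m * x)"
        by (simp add: E1[OF x] E1[OF y] E0)
      also have "expectation (\<lambda>\<omega>. (real (N x \<omega>))\<^sup>2) + m * x * (m * y - m * x) = v * x + m\<^sup>2 * x * y"
        unfolding E2[OF x] by (simp add: power2_eq_square algebra_simps)
      finally show ?thesis .
    qed
  qed
  have product: "(\<integral>\<^sup>+\<omega>. ennreal (real (N x \<omega>) * real (N y \<omega>)) \<partial>M) = ennreal (v * min x y + m\<^sup>2 * x * y)"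
    if x: "0 \<le> x" and y: "0 \<le> y" for x y
  proof -
    have "integrable M (\<lambda>\<omega>. real (N x \<omega>) * real (N y \<omega>))"
      using meas[OF x] meas[OF y] int2[OF x] int2[OF y] by (intro integrable_mult_of_square_integrable) auto
    then have "(\<integral>\<^sup>+\<omega>. ennreal (real (N x \<omega>) * real (N y \<omega>)) \<partial>M) = ennreal (expectation (\<lambda>\<omega>. real (N x \<omega>) * real (N y \<omega>)))"
      by (rule nn_integral_eq_integral) simp
    also have "expectation (\<lambda>\<omega>. real (N x \<omega>) * real (N y \<omega>)) = v * min x y + m\<^sup>2 * x * y"
      using E12[of x y] E12[of y x] x y by (cases "x \<le> y") (simp_all add: mult.commute mult.left_commute)
    finally show ?thesis .
  qed
  \<comment> \<open>In the discrete topology of \<open>nat\<close>, right-continuity means being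
    constant on a right neighbourhood.\<close>
  have "\<forall>\<^sub>F s in at_right t. N s \<omega> = N t \<omega>" if "\<omega> \<in> space M" "0 \<le> t" for \<omega> t
    using cont[OF that] by (simp add: continuous_within tendsto_discrete)
  then show ?thesis
    unfolding linear_moments_def using meas mono mean product by (simp add: m_def v_def)
qed

text \<open>Given the inner times the mixed moment is v min(K x, K y) + m^2 K x K y. The minimum is
  almost surely \<open>K (min x y)\<close>, so the first term contributes v m' min x y and the
  second m^2 v' min x y next to the product of the means.\<close>

lemma linear_moments_compose:
  assumes N: "linear_moments v m N" and vm: "0 \<le> v" "0 \<le> m"
    and K: "linear_moments v' m' K" and vm': "0 \<le> v'" "0 \<le> m'"
    and indep: "\<And>x y i j. 0 \<le> x \<Longrightarrow> 0 \<le> y \<Longrightarrow> 0 \<le> i \<Longrightarrow> 0 \<le> j \<Longrightarrow>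
       indep_rvs (borel \<Otimes>\<^sub>M borel) (\<lambda>\<omega>. (real (K x \<omega>), real (K y \<omega>)))
        (count_space UNIV \<Otimes>\<^sub>M count_space UNIV) (\<lambda>\<omega>. (N i \<omega>, N j \<omega>))"
  shows "linear_moments (v * m' + m\<^sup>2 * v') (m * m') (\<lambda>x \<omega>. N (real (K x \<omega>)) \<omega>)"
proof -
  have K_meas: "random_variable borel (\<lambda>\<omega>. real (K x \<omega>))" if "0 \<le> x" for x
    using linear_momentsD(1)[OF K that] by measurable
  have K_nonneg: "0 \<le> real (K x \<omega>)" for x \<omega> by simp
  note time = N vm K_meas K_meas K_nonneg K_nonneg
      linear_moments_square_integrable[OF K] linear_moments_square_integrable[OF K]
  have meas: "random_variable (count_space UNIV) (\<lambda>\<omega>. N (real (K x \<omega>)) \<omega>)" if "0 \<le> x" for x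
    by (rule linear_moments_time_measurable[OF time]) (use that in \<open>auto intro!: indep\<close>)
  have mean: "(\<integral>\<^sup>+\<omega>. ennreal (real (N (real (K x \<omega>)) \<omega>)) \<partial>M) = ennreal (m * m' * x)" if x: "0 \<le> x" for x
  proof -
    have "(\<integral>\<^sup>+\<omega>. ennreal (real (N (real (K x \<omega>)) \<omega>)) \<partial>M) = (\<integral>\<^sup>+\<omega>. ennreal (m * real (K x \<omega>)) \<partial>M)"
      by (rule linear_moments_time_mean[OF time]) (use x in \<open>auto intro!: indep\<close>)
    also have "\<dots> = ennreal m * (\<integral>\<^sup>+\<omega>. ennreal (real (K x \<omega>)) \<partial>M)"
      using K_meas[OF x] vm by (simp add: ennreal_mult nn_integral_cmult)
    also have "\<dots> = ennreal (m * m' * x)"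
      using x vm vm' by (simp add: linear_momentsD(4)[OF K] mult.assoc flip: ennreal_mult)
    finally show ?thesis .
  qed
  have product: "(\<integral>\<^sup>+\<omega>. ennreal (real (N (real (K x \<omega>)) \<omega>) * real (N (real (K y \<omega>)) \<omega>)) \<partial>M)
      = ennreal ((v * m' + m\<^sup>2 * v') * min x y + (m * m')\<^sup>2 * x * y)" if x: "0 \<le> x" and y: "0 \<le> y" for x y
  proof -
    note [measurable] = K_meas[OF x] K_meas[OF y]
    have min: "0 \<le> min x y" using x y by simp
    note [measurable] = K_meas[OF min]
    have AE_min: "AE \<omega> in M. min (real (K x \<omega>)) (real (K y \<omega>)) = real (K (min x y) \<omega>)"
      using linear_momentsD(3)[OF K x, of y] linear_momentsD(3)[OF K y, of x]
      by (cases "x \<le> y") (auto elim!: eventually_mono simp: min_def)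
    have "(\<integral>\<^sup>+\<omega>. ennreal (real (N (real (K x \<omega>)) \<omega>) * real (N (real (K y \<omega>)) \<omega>)) \<partial>M)
        = (\<integral>\<^sup>+\<omega>. ennreal (v * min (real (K x \<omega>)) (real (K y \<omega>)) + m\<^sup>2 * real (K x \<omega>) * real (K y \<omega>)) \<partial>M)"
      by (rule linear_moments_time_product[OF time]) (use x y in \<open>auto intro!: indep\<close>)
    also have "\<dots> = (\<integral>\<^sup>+\<omega>. ennreal v * ennreal (real (K (min x y) \<omega>))
        + ennreal (m\<^sup>2) * ennreal (real (K x \<omega>) * real (K y \<omega>)) \<partial>M)"
      using AE_min vm
      by (intro nn_integral_cong_AE) (auto elim!: eventually_mono simp: ennreal_plus ennreal_mult mult.assoc)
    also have "\<dots> = ennreal v * (\<integral>\<^sup>+\<omega>. ennreal (real (K (min x y) \<omega>)) \<partial>M)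
        + ennreal (m\<^sup>2) * (\<integral>\<^sup>+\<omega>. ennreal (real (K x \<omega>) * real (K y \<omega>)) \<partial>M)"
      by (simp add: nn_integral_add nn_integral_cmult)
    also have "\<dots> = ennreal v * ennreal (m' * min x y) + ennreal (m\<^sup>2) * ennreal (v' * min x y + m'\<^sup>2 * x * y)"
      by (simp only: linear_momentsD(4)[OF K min] linear_momentsD(5)[OF K x y])
    also have "\<dots> = ennreal (v * (m' * min x y) + m\<^sup>2 * (v' * min x y + m'\<^sup>2 * x * y))"
      using vm vm' min x y by (simp add: ennreal_plus ennreal_mult)
    also have "v * (m' * min x y) + m\<^sup>2 * (v' * min x y + m'\<^sup>2 * x * y)
        = (v * m' + m\<^sup>2 * v') * min x y + (m * m')\<^sup>2 * x * y"
      by (simp add: power_mult_distrib algebra_simps)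
    finally show ?thesis .
  qed
  have mono: "AE \<omega> in M. N (real (K x \<omega>)) \<omega> \<le> N (real (K y \<omega>)) \<omega>" if x: "0 \<le> x" and xy: "x \<le> y" for x y
  proof -
    \<comment> \<open>One null set for all pairs of natural times, since \<open>K\<close> takes its
      values there.\<close>
    have "AE \<omega> in M. \<forall>i j. i \<le> j \<longrightarrow> N (real i) \<omega> \<le> N (real j) \<omega>"
      unfolding AE_all_countable
    proof (intro allI)
      fix i j :: nat
      show "AE \<omega> in M. i \<le> j \<longrightarrow> N (real i) \<omega> \<le> N (real j) \<omega>"
        using linear_momentsD(3)[OF N, of "real i" "real j"] by (cases "i \<le> j") auto
    qed
    then show ?thesis
      using linear_momentsD(3)[OF K x xy] by eventually_elim blast
  qed
  have right: "\<forall>\<^sub>F y in at_right x. N (real (K y \<omega>)) \<omega> = N (real (K x \<omega>)) \<omega>"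
    if "\<omega> \<in> space M" "0 \<le> x" for \<omega> x
    using linear_momentsD(2)[OF K that(2,1)] by eventually_elim simp
  show ?thesis
    unfolding linear_moments_def using meas mono mean product right by blast
qed

end

section \<open>Long-range dependence\<close>

context stable_inverse
begin

lemma long_range_dependent_time_change:
  assumes \<alpha>1: "\<alpha> < 1"
    and Z: "linear_moments v m Z" and v: "0 \<le> v" and m: "0 < m"
    and indep: "\<And>s t x y. 0 \<le> s \<Longrightarrow> 0 \<le> t \<Longrightarrow> 0 \<le> x \<Longrightarrow> 0 \<le> y \<Longrightarrow>
       indep_rvs (borel \<Otimes>\<^sub>M borel) (\<lambda>\<omega>. (Y s \<omega>, Y t \<omega>))
         (count_space UNIV \<Otimes>\<^sub>M count_space UNIV) (\<lambda>\<omega>. (Z x \<omega>, Z y \<omega>))"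
  shows "long_range_dependent (\<lambda>t \<omega>. real (Z (Y t \<omega>) \<omega>))"
proof -
  define X where "X t \<omega> = real (Z (Y t \<omega>) \<omega>)" for t \<omega>
  define U where "U t = expectation (Y t)" for t
  define V where "V t = expectation (\<lambda>\<omega>. (Y t \<omega>)\<^sup>2)" for t
  define C where "C s t = expectation (\<lambda>\<omega>. Y s \<omega> * Y t \<omega>)" for s t
  have m0: "0 \<le> m" using m by simp
  have U_nonneg: "0 \<le> U t" if "0 \<le> t" for t
    using expectation_Y_nonneg[OF that] by (simp add: U_def)
  have C_nonneg: "0 \<le> C s t" if "0 \<le> s" "0 \<le> t" for s t
    unfolding C_def using Y_nonneg[OF that(1)] Y_nonneg[OF that(2)]
    by (intro integral_nonneg_AE AE_I2 mult_nonneg_nonneg)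
  have C_diag: "C t t = V t" for t by (simp add: C_def V_def power2_eq_square)
  note Y_time = Y_measurable Y_nonneg Y_square_integrable indep
  have X_meas: "random_variable borel (X t)" if t: "0 \<le> t" for t
  proof -
    have "random_variable (count_space UNIV) (\<lambda>\<omega>. Z (Y t \<omega>) \<omega>)"
      by (rule linear_moments_time_measurable[where S="Y t" and T="Y t", OF Z v m0]) (use t in \<open>auto intro!: Y_time\<close>)
    then show ?thesis unfolding X_def[abs_def] by measurable
  qed
  have X_mean: "(\<integral>\<^sup>+\<omega>. ennreal (X t \<omega>) \<partial>M) = ennreal (m * U t)" if t: "0 \<le> t" for t
  proof -
    have "(\<integral>\<^sup>+\<omega>. ennreal (X t \<omega>) \<partial>M) = (\<integral>\<^sup>+\<omega>. ennreal (m * Y t \<omega>) \<partial>M)"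
      unfolding X_def
      by (rule linear_moments_time_mean[where S="Y t" and T="Y t", OF Z v m0]) (use t in \<open>auto intro!: Y_time\<close>)
    also have "\<dots> = ennreal (expectation (\<lambda>\<omega>. m * Y t \<omega>))"
      using Y_nonneg[OF t] Y_integrable[OF t] m by (intro nn_integral_eq_integral) (auto intro!: AE_I2)
    finally show ?thesis by (simp add: U_def)
  qed
  have X_product: "(\<integral>\<^sup>+\<omega>. ennreal (X s \<omega> * X t \<omega>) \<partial>M) = ennreal (v * U s + m\<^sup>2 * C s t)"
    if s: "0 \<le> s" and st: "s \<le> t" for s t
  proof -
    have t: "0 \<le> t" using s st by simp
    have "(\<integral>\<^sup>+\<omega>. ennreal (X s \<omega> * X t \<omega>) \<partial>M) = (\<integral>\<^sup>+\<omega>. ennreal (v * min (Y s \<omega>) (Y t \<omega>) + m\<^sup>2 * Y s \<omega> * Y t \<omega>) \<partial>M)"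
      unfolding X_def
      by (rule linear_moments_time_product[where S="Y s" and T="Y t", OF Z v m0]) (use s t in \<open>auto intro!: Y_time\<close>)
    also have "\<dots> = (\<integral>\<^sup>+\<omega>. ennreal (v * Y s \<omega> + m\<^sup>2 * (Y s \<omega> * Y t \<omega>)) \<partial>M)"
      using AE_Y_mono[OF s st] by (intro nn_integral_cong_AE) (auto elim!: eventually_mono simp: min_def mult.assoc)
    also have "\<dots> = ennreal (expectation (\<lambda>\<omega>. v * Y s \<omega> + m\<^sup>2 * (Y s \<omega> * Y t \<omega>)))"
      using Y_nonneg[OF s] Y_nonneg[OF t] Y_integrable[OF s] Y_mult_integrable[OF s t] v
      by (intro nn_integral_eq_integral) (auto intro!: AE_I2)
    finally show ?thesis
      using Y_integrable[OF s] Y_mult_integrable[OF s t] by (simp add: U_def C_def)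
  qed
  have X_nonneg: "0 \<le> X t \<omega>" for t \<omega> by (simp add: X_def)
  have X_square_integrable: "integrable M (\<lambda>\<omega>. (X t \<omega>)\<^sup>2)" if t: "0 \<le> t" for t
    using X_meas[OF t] X_product[OF t order_refl]
    by (intro integrableI_nonneg) (auto simp: power2_eq_square)
  have X_integrable: "integrable M (X t)" if t: "0 \<le> t" for t
    by (rule square_integrable_imp_integrable[OF X_meas[OF t] X_square_integrable[OF t]])
  have X_mult_integrable: "integrable M (\<lambda>\<omega>. X s \<omega> * X t \<omega>)" if "0 \<le> s" "0 \<le> t" for s t
    by (intro integrable_mult_of_square_integrable X_meas X_square_integrable that)
  have E_X: "expectation (X t) = m * U t" if t: "0 \<le> t" for t
  proof -
    have "ennreal (expectation (X t)) = ennreal (m * U t)"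
      using nn_integral_eq_integral[OF X_integrable[OF t]] X_mean[OF t] X_nonneg by simp
    then show ?thesis
      using U_nonneg[OF t] m X_nonneg by (subst (asm) ennreal_inj) (auto intro: integral_nonneg_AE)
  qed
  have E_XX: "expectation (\<lambda>\<omega>. X s \<omega> * X t \<omega>) = v * U s + m\<^sup>2 * C s t" if s: "0 \<le> s" and st: "s \<le> t" for s t
  proof -
    have t: "0 \<le> t" using s st by simp
    have "ennreal (expectation (\<lambda>\<omega>. X s \<omega> * X t \<omega>)) = ennreal (v * U s + m\<^sup>2 * C s t)"
      using nn_integral_eq_integral[OF X_mult_integrable[OF s t]] X_product[OF s st] X_nonneg by simp
    then show ?thesis
      using U_nonneg[OF s] C_nonneg[OF s t] v X_nonneg
      by (subst (asm) ennreal_inj) (auto intro!: integral_nonneg_AE add_nonneg_nonneg mult_nonneg_nonneg)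
  qed
  have cov: "covariance (X s) (X t) = v * U s + m\<^sup>2 * (C s t - U s * U t)" if s: "0 \<le> s" and st: "s \<le> t" for s t
  proof -
    have t: "0 \<le> t" using s st by simp
    have "covariance (X s) (X t) = expectation (\<lambda>\<omega>. X s \<omega> * X t \<omega> - m * U t * X s \<omega> - m * U s * X t \<omega> + m * U s * (m * U t))"
      unfolding covariance_def E_X[OF s] E_X[OF t]
      by (rule Bochner_Integration.integral_cong) (simp_all add: algebra_simps)
    also have "\<dots> = expectation (\<lambda>\<omega>. X s \<omega> * X t \<omega>) - m * U t * (m * U s) - m * U s * (m * U t) + m * U s * (m * U t)"
      using X_integrable[OF s] X_integrable[OF t] X_mult_integrable[OF s t]
      by (simp add: prob_space E_X[OF s] E_X[OF t])
    finally show ?thesis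
      by (simp add: E_XX[OF s st] power2_eq_square algebra_simps)
  qed
  have var_cov: "variance (X t) = covariance (X t) (X t)" for t
    by (simp add: covariance_def power2_eq_square)
  \<comment> \<open>The variance of \<open>Y 1\<close>; m^2 w is the coefficient of t^(2 \<alpha>)
    in the variance of \<open>X t\<close>, so its positivity fixes the decay rate.\<close>
  define w where "w = V 1 - (U 1)\<^sup>2"
  have w: "0 < w" using variance_Y_pos[OF \<alpha>1] by (simp add: w_def U_def V_def)
  have U1: "0 < U 1" using expectation_Y_pos by (simp add: U_def)
  have U_scale: "U t = t powr \<alpha> * U 1" if "0 < t" for t
    using expectation_Y_scaling[OF that] by (simp add: U_def)
  have V_scale: "V t = (t powr \<alpha>)\<^sup>2 * V 1" if "0 < t" for t
    using expectation_Y_square_scaling[OF that]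
    by (simp add: V_def power2_eq_square flip: powr_add)
  have V1: "0 < V 1" using w U1 by (simp add: w_def) (smt (verit) zero_le_power2)
  have var: "variance (X t) = (t powr \<alpha>)\<^sup>2 * (v * U 1 * t powr - \<alpha> + m\<^sup>2 * w)" if t: "0 < t" for t
  proof -
    have "variance (X t) = v * U t + m\<^sup>2 * (V t - (U t)\<^sup>2)"
      unfolding var_cov using t by (simp add: cov C_diag power2_eq_square)
    also have "\<dots> = v * U 1 * t powr \<alpha> + m\<^sup>2 * w * (t powr \<alpha>)\<^sup>2"
      by (simp add: U_scale[OF t] V_scale[OF t] w_def algebra_simps power_mult_distrib)
    also have "t powr \<alpha> = (t powr \<alpha>)\<^sup>2 * t powr - \<alpha>"
      using t by (simp add: power2_eq_square flip: powr_add)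
    finally show ?thesis
      using t by (simp add: algebra_simps power2_eq_square flip: powr_add)
  qed
  have var_pos: "0 < variance (X t)" if t: "0 < t" for t
    unfolding var[OF t] using t v U1 m w
    by (intro mult_pos_pos add_nonneg_pos mult_nonneg_nonneg) auto
  have square: "square_integrable_process X"
    unfolding square_integrable_process_def using X_meas X_square_integrable by blast
  have not_stationary: "\<not> stationary_process X"
  proof
    assume "stationary_process X"
    \<comment> \<open>The mean grows like t^\<alpha>, so comparing times 1 and 2 refutes
      stationarity.\<close>
    then have "expectation (X 2) = expectation (X 0)" "expectation (X 1) = expectation (X 0)"
      unfolding stationary_process_def by (blast intro: zero_le_numeral zero_le_one)+
    then have "m * U 2 = m * U 1"
      using E_X[of 2] E_X[of 1] by simp
    then have "(2 :: real) powr \<alpha> = 1"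
      using m U1 U_scale[of 2] by simp
    moreover have "1 < (2 :: real) powr \<alpha>"
      using index_pos by simp
    ultimately show False by simp
  qed
  have "\<exists>c>0. (\<lambda>t. correlation (X s) (X t)) \<sim>[at_top] (\<lambda>t. c * t powr - \<alpha>)" if s: "0 < s" for s
  proof -
    \<comment> \<open>\<open>L\<close> is the limit of the covariance as t grows; \<open>c\<close>
      is then forced by requiring the quotient to tend to 1.\<close>
    define L where "L = v * U s + m\<^sup>2 * (V s / 2)"
    define c where "c = L / (sqrt (variance (X s)) * sqrt (m\<^sup>2 * w))"
    have L: "0 < L"
      unfolding L_def using s v m U_nonneg[of s] V1 V_scale[OF s]
      by (intro add_nonneg_pos mult_nonneg_nonneg mult_pos_pos) auto
    have c: "0 < c"
      unfolding c_def using L var_pos[OF s] m w by simp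
    have "((\<lambda>t. C s t - U s * U t) \<longlongrightarrow> V s / 2) at_top"
      using tendsto_covariance_Y[OF \<alpha>1 s] by (simp add: C_def U_def V_def)
    then have num: "((\<lambda>t. v * U s + m\<^sup>2 * (C s t - U s * U t)) \<longlongrightarrow> L) at_top"
      unfolding L_def by (intro tendsto_intros)
    have "((\<lambda>t. t powr - \<alpha>) \<longlongrightarrow> 0) at_top"
      using index_pos by real_asymp
    then have den: "((\<lambda>t. sqrt (v * U 1 * t powr - \<alpha> + m\<^sup>2 * w)) \<longlongrightarrow> sqrt (v * U 1 * 0 + m\<^sup>2 * w)) at_top"
      by (intro tendsto_intros)
    have lim: "((\<lambda>t. (v * U s + m\<^sup>2 * (C s t - U s * U t))
          / (c * sqrt (variance (X s)) * sqrt (v * U 1 * t powr - \<alpha> + m\<^sup>2 * w)))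
        \<longlongrightarrow> L / (c * sqrt (variance (X s)) * sqrt (v * U 1 * 0 + m\<^sup>2 * w))) at_top"
      by (intro tendsto_divide tendsto_mult tendsto_const num den) (use c var_pos[OF s] m w in auto)
    have one: "L / (c * sqrt (variance (X s)) * sqrt (v * U 1 * 0 + m\<^sup>2 * w)) = 1"
      using L var_pos[OF s] m w by (simp add: c_def)
    \<comment> \<open>The factor t^\<alpha> in the standard deviation of \<open>X t\<close> cancels
      against t^-\<alpha> in the comparison function.\<close>
    have ev: "\<forall>\<^sub>F t in at_top. (v * U s + m\<^sup>2 * (C s t - U s * U t))
          / (c * sqrt (variance (X s)) * sqrt (v * U 1 * t powr - \<alpha> + m\<^sup>2 * w))
        = correlation (X s) (X t) / (c * t powr - \<alpha>)"
      using eventually_gt_at_top[of s]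
    proof eventually_elim
      case (elim t)
      then have t: "0 < t" using s by simp
      have "sqrt (variance (X s) * variance (X t))
          = sqrt (variance (X s)) * (t powr \<alpha> * sqrt (v * U 1 * t powr - \<alpha> + m\<^sup>2 * w))"
        unfolding var[OF t] by (simp add: real_sqrt_mult)
      moreover have "t powr \<alpha> * t powr - \<alpha> = 1"
        using t by (simp flip: powr_add)
      ultimately show ?case
        using elim s t cov[of s t]
        by (simp add: correlation_def powr_minus field_simps)
    qed
    have "((\<lambda>t. correlation (X s) (X t) / (c * t powr - \<alpha>)) \<longlongrightarrow> 1) at_top"
      using Lim_transform_eventually[OF lim ev] unfolding one .
    then have "(\<lambda>t. correlation (X s) (X t)) \<sim>[at_top] (\<lambda>t. c * t powr - \<alpha>)"
      by (rule asymp_equivI')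
    then show ?thesis using c by blast
  qed
  then have "long_range_dependent X"
    unfolding long_range_dependent_def using square not_stationary index_pos \<alpha>1 by blast
  then show ?thesis by (simp add: X_def[abs_def])
qed

end

section \<open>Assembly from the independent sample paths\<close>

lemma measurable_path_component: "0 \<le> t \<Longrightarrow> (\<lambda>p. p t) \<in> path_space N \<rightarrow>\<^sub>M N"
  by (rule measurable_component_singleton) simp

theorem theorem5p2:
  fixes P :: "'w measure"
    and \<alpha> :: real
    and k0 k :: nat
    and mu lam :: "nat \<Rightarrow> real"
    and M0 M :: "real \<Rightarrow> 'w \<Rightarrow> nat"
    and Y :: "real \<Rightarrow> 'w \<Rightarrow> real"
  assumes "prob_space P"
    and "0 < \<alpha>" and "\<alpha> < 1"
    and "1 \<le> k0" and "\<forall>j\<in>{1..k0}. 0 < mu j"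
    and "1 \<le> k" and "\<forall>j\<in>{1..k}. 0 < lam j"
    and "prob_space.generalized_counting_process P k0 mu M0"
    and "prob_space.generalized_counting_process P k lam M"
    and "prob_space.inverse_stable_subordinator P \<alpha> Y"
    and "prob_space.indep_rvs P
           (path_space (count_space UNIV)) (sample_path M0)
           (path_space (count_space UNIV)) (sample_path M)"
    and "prob_space.indep_rvs P
           (path_space borel) (sample_path Y)
           (path_space (count_space UNIV) \<Otimes>\<^sub>M path_space (count_space UNIV))
           (\<lambda>\<omega>. (sample_path M \<omega>, sample_path M0 \<omega>))"
  shows "prob_space.long_range_dependent P
           (\<lambda>t \<omega>. real (M (real (M0 (Y t \<omega>) \<omega>)) \<omega>))"
proof -
  interpret prob_space P by fact
  obtain D where D: "stable_subordinator \<alpha> D"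
    and Y: "\<forall>t\<ge>0. \<forall>\<omega>\<in>space P.
      Y t \<omega> = (if \<exists>x>0. t < D x \<omega> then Inf {x. 0 < x \<and> t < D x \<omega>} else 0)"
    using assms(10) unfolding inverse_stable_subordinator_def by blast
  \<comment> \<open>Measurability of \<open>Y t\<close> is read off the independence hypothesis,
    which makes the sample path a random element.\<close>
  have Y_path: "random_variable (path_space borel) (sample_path Y)"
    using assms(12) by (simp add: indep_rvs_def)
  have Y_meas: "random_variable borel (Y t)" if "0 \<le> t" for t
    using measurable_compose[OF Y_path measurable_path_component[OF that]] that
    by (simp add: sample_path_def)
  interpret stable_inverse P \<alpha> D Y
    by unfold_locales (use assms(2) D Y Y_meas in blast)+
  define v0 where "v0 = (\<Sum>j=1..k0. (real j)\<^sup>2 * mu j)"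
  define m0 where "m0 = (\<Sum>j=1..k0. real j * mu j)"
  define v1 where "v1 = (\<Sum>j=1..k. (real j)\<^sup>2 * lam j)"
  define m1 where "m1 = (\<Sum>j=1..k. real j * lam j)"
  have pos: "0 < v0" "0 < m0" "0 < v1" "0 < m1"
    unfolding v0_def m0_def v1_def m1_def using assms(4-7) by (auto intro!: sum_pos)
  have M0: "linear_moments v0 m0 M0"
    unfolding v0_def m0_def
    by (rule generalized_counting_process_linear_moments[OF assms(8) assms(4) assms(5)])
  have M: "linear_moments v1 m1 M"
    unfolding v1_def m1_def
    by (rule generalized_counting_process_linear_moments[OF assms(9) assms(6) assms(7)])
  have Z: "linear_moments (v1 * m0 + m1\<^sup>2 * v0) (m1 * m0) (\<lambda>x \<omega>. M (real (M0 x \<omega>)) \<omega>)"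
  proof (rule linear_moments_compose[OF M _ _ M0])
    fix x y i j :: real
    assume le: "0 \<le> x" "0 \<le> y" "0 \<le> i" "0 \<le> j"
    have f: "(\<lambda>p. (real (p x), real (p y))) \<in> path_space (count_space UNIV) \<rightarrow>\<^sub>M borel \<Otimes>\<^sub>M borel"
      by (intro measurable_Pair measurable_compose[OF measurable_path_component[OF le(1)]]
          measurable_compose[OF measurable_path_component[OF le(2)]]) simp_all
    have g: "(\<lambda>p. (p i, p j)) \<in> path_space (count_space UNIV) \<rightarrow>\<^sub>M count_space UNIV \<Otimes>\<^sub>M (count_space UNIV :: nat measure)"
      by (intro measurable_Pair measurable_path_component le)
    show "indep_rvs (borel \<Otimes>\<^sub>M borel) (\<lambda>\<omega>. (real (M0 x \<omega>), real (M0 y \<omega>)))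
        (count_space UNIV \<Otimes>\<^sub>M count_space UNIV) (\<lambda>\<omega>. (M i \<omega>, M j \<omega>))"
      using indep_rvs_compose[OF assms(11) f g] le by (simp add: sample_path_def)
  qed (use pos in simp_all)
  show ?thesis
  proof (rule long_range_dependent_time_change[OF assms(3) Z])
    fix s t x y :: real
    assume le: "0 \<le> s" "0 \<le> t" "0 \<le> x" "0 \<le> y"
    have f: "(\<lambda>p. (p s, p t)) \<in> path_space borel \<rightarrow>\<^sub>M borel \<Otimes>\<^sub>M (borel :: real measure)"
      by (intro measurable_Pair measurable_path_component le)
    \<comment> \<open>The inner time is a natural number, so evaluating the outer path there is a
      countable case distinction; evaluation at a variable real time is not jointly measurable for
      the product sigma-algebra.\<close>
    have eval: "(\<lambda>z. fst z (real (snd z x)))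
        \<in> path_space (count_space UNIV) \<Otimes>\<^sub>M path_space (count_space UNIV) \<rightarrow>\<^sub>M (count_space UNIV :: nat measure)"
      if "0 \<le> x" for x
    proof (rule measurable_compose_countable[where f="\<lambda>i z. fst z (real i)" and g="\<lambda>z. snd z x"])
      show "(\<lambda>z. fst z (real i)) \<in> path_space (count_space UNIV) \<Otimes>\<^sub>M path_space (count_space UNIV) \<rightarrow>\<^sub>M (count_space UNIV :: nat measure)"
        for i :: nat
        by (rule measurable_compose[OF measurable_fst measurable_path_component]) simp
      show "(\<lambda>z. snd z x) \<in> path_space (count_space UNIV) \<Otimes>\<^sub>M path_space (count_space UNIV) \<rightarrow>\<^sub>M (count_space UNIV :: nat measure)"
        by (rule measurable_compose[OF measurable_snd measurable_path_component[OF that]])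
    qed
    have g: "(\<lambda>z. (fst z (real (snd z x)), fst z (real (snd z y))))
        \<in> path_space (count_space UNIV) \<Otimes>\<^sub>M path_space (count_space UNIV)
          \<rightarrow>\<^sub>M count_space UNIV \<Otimes>\<^sub>M (count_space UNIV :: nat measure)"
      by (intro measurable_Pair eval le)
    show "indep_rvs (borel \<Otimes>\<^sub>M borel) (\<lambda>\<omega>. (Y s \<omega>, Y t \<omega>))
        (count_space UNIV \<Otimes>\<^sub>M count_space UNIV)
        (\<lambda>\<omega>. (M (real (M0 x \<omega>)) \<omega>, M (real (M0 y \<omega>)) \<omega>))"
      using indep_rvs_compose[OF assms(12) f g] le by (simp add: sample_path_def)
  qed (use pos in simp_all)
qed

end
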